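(* Let $(\mathcal{X},d)$ be a locally compact Polish space and $\varphi\in\mathrm{MI}$. Given an integer $K\ge2$, measures $(\mu_k)_{0\le k\le K-1}\in\mathcal{P}^d_\varphi(\mathcal{X})^K$ and weights $\tau=(\tau_k)_{0\le k\le K-1}\in\Delta^K$, there exists a measure $\gamma_B\in\Pi(\mu_0,\dots,\mu_{K-1})$ minimizing $$\gamma\mapsto\int_{\mathcal{X}^K}\inf_{x\in\mathcal{X}}\sum_{k=0}^{K-1}\tau_k\varphi(d(x,x_k))\,d\gamma(x_0,\dots,x_{K-1})$$ over $\Pi(\mu_0,\dots,\mu_{K-1})$. Moreover, let $T_B^\tau:\mathcal{X}^K\to\mathcal{X}$ be a Borel barycenter map. Then the measure $\mu_B:=(T_B^\tau)_\#\gamma_B$ is a barycenter of $(\mu_k)_{0\le k\le K-1}$ with weights $\tau$. Furthermore, if this map $T_B^\tau$ is unique, any barycenter $\mu_B$ is of the form $\mu_B=(T_B^\tau)_\#\gamma_B$ for some such minimizer $\gamma_B$.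
   Context: $\mathrm{MI}$ is the set of increasing bijections $\varphi:\mathbb{R}_{\ge0}\to\mathbb{R}_{\ge0}$ such that $F_\varphi(x_0,x_1):=\varphi(\varphi^{-1}(x_0)+\varphi^{-1}(x_1))$ is concave on $\mathbb{R}_{\ge0}^2$. $\Delta^K=\{(\tau_0,\dots,\tau_{K-1})\in[0,1]^K:\sum_k\tau_k=1\}$. $\mathcal{P}^d_\varphi(\mathcal{X})$ is the set of Borel probability measures $\mu$ on $\mathcal{X}$ with $\int\varphi(d(x,y))\,d\mu(x)<+\infty$ for some $y\in\mathcal{X}$. $\Pi(\mu_0,\dots,\mu_{K-1})$ is the set of Borel probability measures on $\mathcal{X}^K$ with marginals $\mu_0,\dots,\mu_{K-1}$, and $T_\#\gamma$ denotes push-forward. $\mathrm{W}^d_\varphi(\mu,\nu):=\varphi^{-1}\big(\inf_{\gamma\in\Pi(\mu,\nu)}\int\varphi(d(x,y))\,d\gamma(x,y)\big)$. A barycenter of $(\mu_k)$ with weights $\tau$ is a minimizer over $\nu\in\mathcal{P}^d_\varphi(\mathcal{X})$ of $\sum_{k=0}^{K-1}\tau_k\,\varphi(\mathrm{W}^d_\varphi(\nu,\mu_k))$. A Borel barycenter map is a Borel map $T_B^\tau:\mathcal{X}^K\to\mathcal{X}$ which associates to each $(x_0,\dots,x_{K-1})$ a minimizer of $x\mapsto\sum_{k=0}^{K-1}\tau_k\varphi(d(x,x_k))$. *)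

theory Defs
  imports "HOL-Probability.Probability"
begin

text \<open>
  The space \<open>(X, d)\<close> is a type of class \<open>polish_space\<close> with \<open>d = dist\<close>.  A function \<open>\<phi>\<close> on the
  nonnegative reals is a total function \<open>real \<Rightarrow> real\<close> of which only the restriction to \<open>{0..}\<close>
  is ever used.
\<close>

abbreviation phi_inv :: "(real \<Rightarrow> real) \<Rightarrow> real \<Rightarrow> real" where
  "phi_inv \<phi> \<equiv> inv_into {0..} \<phi>"

definition MI :: "(real \<Rightarrow> real) set" where
  "MI = {\<phi>. bij_betw \<phi> {0..} {0..} \<and> strict_mono_on {0..} \<phi> \<and>
             concave_on ({0..} \<times> {0..}) (\<lambda>(x0, x1). \<phi> (phi_inv \<phi> x0 + phi_inv \<phi> x1))}"

definition weights :: "nat \<Rightarrow> (nat \<Rightarrow> real) set" where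
  "weights K = {\<tau>. (\<forall>k<K. \<tau> k \<in> {0..1}) \<and> (\<Sum>k<K. \<tau> k) = 1}"

definition borel_probs :: "'a::topological_space measure set" where
  "borel_probs = {\<mu>. sets \<mu> = sets borel \<and> prob_space \<mu>}"

definition P_phi :: "(real \<Rightarrow> real) \<Rightarrow> 'a::polish_space measure set" where
  "P_phi \<phi> = {\<mu> \<in> borel_probs. \<exists>y. (\<integral>\<^sup>+ x. ennreal (\<phi> (dist x y)) \<partial>\<mu>) < \<infinity>}"

text \<open>
  \<open>X^K\<close> is the set of extensional functions on \<open>{..<K}\<close>.  Since \<open>X\<close> is second countable, the
  Borel sigma-algebra of the product topology is the product sigma-algebra.
\<close>

abbreviation borel_pow :: "nat \<Rightarrow> (nat \<Rightarrow> 'a::polish_space) measure" where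
  "borel_pow K \<equiv> Pi\<^sub>M {..<K} (\<lambda>_. borel)"

definition couplings :: "nat \<Rightarrow> (nat \<Rightarrow> 'a::polish_space measure) \<Rightarrow> (nat \<Rightarrow> 'a) measure set" where
  "couplings K \<mu> = {\<gamma>. sets \<gamma> = sets (borel_pow K) \<and> prob_space \<gamma> \<and>
                       (\<forall>k<K. distr \<gamma> borel (\<lambda>x. x k) = \<mu> k)}"

definition couplings2 :: "'a::polish_space measure \<Rightarrow> 'a measure \<Rightarrow> ('a \<times> 'a) measure set" where
  "couplings2 \<mu> \<nu> = {\<gamma> \<in> borel_probs. distr \<gamma> borel fst = \<mu> \<and> distr \<gamma> borel snd = \<nu>}"

text \<open>
  For \<open>\<phi> \<in> MI\<close> and \<open>\<mu>, \<nu> \<in> P_phi \<phi>\<close> the infimum below is finite (the product measure has finite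
  cost), so \<open>enn2real\<close> loses nothing there; \<open>W_phi\<close> is only ever applied to such measures.
\<close>

definition W_phi :: "(real \<Rightarrow> real) \<Rightarrow> 'a::polish_space measure \<Rightarrow> 'a measure \<Rightarrow> real" where
  "W_phi \<phi> \<mu> \<nu> =
     phi_inv \<phi> (enn2real (INF \<gamma>\<in>couplings2 \<mu> \<nu>. \<integral>\<^sup>+ (x, y). ennreal (\<phi> (dist x y)) \<partial>\<gamma>))"

definition is_barycenter ::
  "(real \<Rightarrow> real) \<Rightarrow> nat \<Rightarrow> (nat \<Rightarrow> real) \<Rightarrow> (nat \<Rightarrow> 'a::polish_space measure) \<Rightarrow> 'a measure \<Rightarrow> bool"
  where
  "is_barycenter \<phi> K \<tau> \<mu> \<nu> \<longleftrightarrow> \<nu> \<in> P_phi \<phi> \<and>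
     (\<forall>\<nu>'\<in>P_phi \<phi>. (\<Sum>k<K. \<tau> k * \<phi> (W_phi \<phi> \<nu> (\<mu> k))) \<le> (\<Sum>k<K. \<tau> k * \<phi> (W_phi \<phi> \<nu>' (\<mu> k))))"

definition point_cost ::
  "(real \<Rightarrow> real) \<Rightarrow> nat \<Rightarrow> (nat \<Rightarrow> real) \<Rightarrow> (nat \<Rightarrow> 'a::polish_space) \<Rightarrow> 'a \<Rightarrow> real" where
  "point_cost \<phi> K \<tau> x z = (\<Sum>k<K. \<tau> k * \<phi> (dist z (x k)))"

definition borel_barycenter_map ::
  "(real \<Rightarrow> real) \<Rightarrow> nat \<Rightarrow> (nat \<Rightarrow> real) \<Rightarrow> ((nat \<Rightarrow> 'a::polish_space) \<Rightarrow> 'a) \<Rightarrow> bool" where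
  "borel_barycenter_map \<phi> K \<tau> T \<longleftrightarrow> T \<in> measurable (borel_pow K) borel \<and>
     (\<forall>x\<in>space (borel_pow K). \<forall>z. point_cost \<phi> K \<tau> x (T x) \<le> point_cost \<phi> K \<tau> x z)"

definition multi_cost ::
  "(real \<Rightarrow> real) \<Rightarrow> nat \<Rightarrow> (nat \<Rightarrow> real) \<Rightarrow> (nat \<Rightarrow> 'a::polish_space) measure \<Rightarrow> ennreal" where
  "multi_cost \<phi> K \<tau> \<gamma> = (\<integral>\<^sup>+ x. ennreal (INF z. point_cost \<phi> K \<tau> x z) \<partial>\<gamma>)"

definition optimal_coupling ::
  "(real \<Rightarrow> real) \<Rightarrow> nat \<Rightarrow> (nat \<Rightarrow> real) \<Rightarrow> (nat \<Rightarrow> 'a::polish_space measure) \<Rightarrow>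
     (nat \<Rightarrow> 'a) measure \<Rightarrow> bool" where
  "optimal_coupling \<phi> K \<tau> \<mu> \<gamma> \<longleftrightarrow> \<gamma> \<in> couplings K \<mu> \<and>
     (\<forall>\<gamma>'\<in>couplings K \<mu>. multi_cost \<phi> K \<tau> \<gamma> \<le> multi_cost \<phi> K \<tau> \<gamma>')"

end

theory Submission
  imports Defs
begin

text \<open>
  Write \<open>c x\<close> for the infimum over \<open>z\<close> of the weighted cost from \<open>z\<close> to the points \<open>x k\<close>.  The barycenter
  problem for measures and the coupling problem for \<open>c\<close> are both shadows of one problem about star
  couplings: couplings of \<open>\<mu> 0, \<dots>, \<mu> (K - 1)\<close> and a center measure \<open>\<nu>\<close>, with the weighted cost
  from the center to the other points.  Forgetting the center gives a coupling of the \<open>\<mu> k\<close> whose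
  integral of \<open>c\<close> is at most the star cost (\<open>multi_cost_restrict\<close>).  Forgetting all but the pairs
  of the center with one other point gives transport plans, so the barycenter functional of \<open>\<nu>\<close> is at
  most the star cost (\<open>barycenter_functional_le_star_cost\<close>).  Both inequalities are sharp: a barycenter
  map \<open>T\<close> supplies the center for a given coupling (\<open>barycenter_map_coupling\<close>), and transport plans
  from a given \<open>\<nu>\<close> can be glued along \<open>\<nu>\<close> (\<open>star_coupling_exists\<close>).  Hence the two problems have the
  same minimal value, and \<open>T\<close> pushes minimisers of one to minimisers of the other.

  For the converse, take a star coupling that realises the functional of a barycenter \<open>\<nu>\<close>.  Its
  restriction is then an optimal coupling and its cost equals the finite integral of \<open>c\<close>, so almost
  surely the center minimises the weighted cost.  If \<open>T\<close> is the only barycenter map, minimisers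
  are unique at every point, since \<open>T\<close> can be modified at a single point.  So the center is \<open>T x\<close>
  almost surely, and \<open>\<nu>\<close> is the push-forward of the optimal coupling.

  The analytic content is the existence of minimisers for lower semicontinuous costs over couplings
  with prescribed marginals (\<open>optimal_coupling_exists\<close>).  It rests on the fixed marginals and on the
  fact that a Polish space is a measurable retract of the space of bit sequences: all coordinates of
  a point are coded into one real number, Helly's theorem gives a weak limit on the line, and the
  limit is decoded.  The same theorem, applied to pairs, upgrades an elementary approximate
  gluing to exact gluing.  The concavity in the definition of \<open>MI\<close>
  yields the growth bound \<open>MI_growth\<close>, which makes the finiteness of moments independent of the base point.
\<close>

section \<open>Reading the digits of a Cantor number continuously\<close>

text \<open>
  On the Cantor set, this is the indicator of the right half, extended to a continuous function of
  the line: it vanishes on \<open>{..1/3}\<close> and equals 1 on \<open>{2/3..}\<close>.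
\<close>

definition leading_digit :: "real \<Rightarrow> real" where
  "leading_digit y = max 0 (min 1 (3 * y - 1))"

text \<open>
  On the Cantor set this iterates the shift that deletes the first ternary digit.  Replacing the
  digit by its continuous extension keeps every iterate continuous on the whole line.
\<close>

primrec cantor_orbit :: "nat \<Rightarrow> real \<Rightarrow> real" where
  "cantor_orbit 0 y = y"
| "cantor_orbit (Suc i) y = 3 * cantor_orbit i y - 2 * leading_digit (cantor_orbit i y)"

definition cantor_digit :: "nat \<Rightarrow> real \<Rightarrow> real" where
  "cantor_digit i y = leading_digit (cantor_orbit i y)"

definition cantor_number :: "(nat \<Rightarrow> bool) \<Rightarrow> real" where
  "cantor_number b = (\<Sum>i. 2 * of_bool (b i) / 3 ^ Suc i)"

lemma summable_cantor_number: "summable (\<lambda>i. 2 * of_bool (b i) / 3 ^ Suc i :: real)"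
proof (rule summable_comparison_test')
  show "summable (\<lambda>i. (2/3) * (1/3::real) ^ i)"
    by (intro summable_mult summable_geometric) simp
qed (auto simp: power_one_over field_simps)

lemma cantor_number_unfold:
  "cantor_number b = (2 * of_bool (b 0) + cantor_number (\<lambda>i. b (Suc i))) / 3"
proof -
  have "cantor_number b - 2 * of_bool (b 0) / 3 = (\<Sum>i. (2 * of_bool (b (Suc i)) / 3 ^ Suc i) / 3)"
    unfolding cantor_number_def
    using suminf_split_head[OF summable_cantor_number[of b]] by (simp add: field_simps)
  also have "\<dots> = cantor_number (\<lambda>i. b (Suc i)) / 3"
    unfolding cantor_number_def by (rule suminf_divide[OF summable_cantor_number])
  finally show ?thesis by (simp add: field_simps)
qed

lemma cantor_number_range: "0 \<le> cantor_number b" "cantor_number b \<le> 1"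
proof -
  show "0 \<le> cantor_number b"
    unfolding cantor_number_def by (intro suminf_nonneg summable_cantor_number) auto
  have "cantor_number b \<le> (\<Sum>i. (2/3) * (1/3::real) ^ i)"
    unfolding cantor_number_def
    by (intro suminf_le summable_cantor_number summable_mult summable_geometric)
      (auto simp: power_one_over field_simps)
  also have "\<dots> = 1"
    by (subst suminf_mult) (auto simp: suminf_geometric intro!: summable_geometric)
  finally show "cantor_number b \<le> 1" .
qed

lemma leading_digit_cantor_number: "leading_digit (cantor_number b) = of_bool (b 0)"
  using cantor_number_range[of "\<lambda>i. b (Suc i)"]
  by (subst cantor_number_unfold) (auto simp: leading_digit_def)

lemma cantor_orbit_cantor_number: "cantor_orbit i (cantor_number b) = cantor_number (\<lambda>j. b (j + i))"
proof (induction i)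
  case (Suc i)
  show ?case
    unfolding cantor_orbit.simps Suc.IH leading_digit_cantor_number
    using cantor_number_unfold[of "\<lambda>j. b (j + i)"] by simp
qed simp

lemma cantor_digit_cantor_number: "cantor_digit i (cantor_number b) = of_bool (b i)"
  by (simp add: cantor_digit_def cantor_orbit_cantor_number leading_digit_cantor_number)

lemma cantor_digit_range: "0 \<le> cantor_digit i y" "cantor_digit i y \<le> 1"
  by (auto simp: cantor_digit_def leading_digit_def)

lemma isCont_leading_digit: "isCont leading_digit y"
  unfolding leading_digit_def[abs_def] by (intro continuous_intros)

lemma isCont_cantor_orbit: "isCont (cantor_orbit i) y"
proof (induction i)
  case (Suc i)
  then show ?case
    by (auto intro!: continuous_intros isCont_o2[OF _ isCont_leading_digit] simp: cantor_orbit.simps[abs_def])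
qed simp

lemma isCont_cantor_digit [continuous_intros]: "isCont (\<lambda>y. cantor_digit i y) y"
  unfolding cantor_digit_def by (rule isCont_o2[OF isCont_cantor_orbit isCont_leading_digit])

lemma borel_measurable_cantor_digit [measurable]: "cantor_digit i \<in> borel_measurable borel"
  by (intro borel_measurable_continuous_onI continuous_at_imp_continuous_on ballI isCont_cantor_digit)

lemma borel_measurable_cantor_number:
  assumes [measurable]: "\<And>i. Measurable.pred N (\<lambda>x. b x i)"
  shows "(\<lambda>x. cantor_number (b x)) \<in> borel_measurable N"
  unfolding cantor_number_def by measurable

text \<open>
  Coding countably many events into one real number turns weak compactness of measures on the line
  (Helly's theorem) into compactness for an arbitrary sequence of probability spaces.  The digits of
  a Cantor number are continuous functions, so the probabilities of
  all finite Boolean combinations of the events pass to the weak limit.  The limit measure still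
  sees only the digits 0 and 1, because \<open>d * (1 - d)\<close> is a continuous function of the digit \<open>d\<close> whose integrals vanish along the sequence.
\<close>

lemma cantor_compactness:
  fixes N :: "nat \<Rightarrow> 'b measure" and b :: "'b \<Rightarrow> nat \<Rightarrow> bool"
  assumes N: "\<And>n. prob_space (N n)"
    and b [measurable]: "\<And>n i. Measurable.pred (N n) (\<lambda>x. b x i)"
  obtains r M where "strict_mono r" "real_distribution M"
    "\<And>f B. (\<And>y. isCont f y) \<Longrightarrow> (\<And>y. norm (f y) \<le> B) \<Longrightarrow>
       (\<lambda>n. \<integral>x. f (cantor_number (b x)) \<partial>N (r n)) \<longlonglongrightarrow> (\<integral>y. f y \<partial>M :: real)"
    "AE y in M. \<forall>i. cantor_digit i y \<in> {0, 1}"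
proof -
  have [measurable]: "(\<lambda>x. cantor_number (b x)) \<in> borel_measurable (N n)" for n
    by (intro borel_measurable_cantor_number) measurable
  define \<mu> where "\<mu> n = distr (N n) borel (\<lambda>x. cantor_number (b x))" for n
  have rd: "real_distribution (\<mu> n)" for n
    unfolding real_distribution_def real_distribution_axioms_def \<mu>_def
    by (auto intro!: prob_space.prob_space_distr N)
  have full: "measure (\<mu> n) {-1<..1} = 1" for n
  proof -
    interpret prob_space "N n" by (rule N)
    have "measure (\<mu> n) {-1<..1} = prob ((\<lambda>x. cantor_number (b x)) -` {-1<..1} \<inter> space (N n))"
      unfolding \<mu>_def by (rule measure_distr) auto
    also have "(\<lambda>x. cantor_number (b x)) -` {-1<..1} \<inter> space (N n) = space (N n)"
      using less_le_trans[OF _ cantor_number_range(1), of "-1"] cantor_number_range(2) by auto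
    finally show ?thesis by (simp add: prob_space)
  qed
  have "tight \<mu>"
    unfolding tight_def
  proof (intro conjI allI impI rd)
    fix e :: real assume "e > 0"
    then show "\<exists>a b. a < b \<and> (\<forall>n. 1 - e < measure (\<mu> n) {a<..b})"
      using full by (intro exI[of _ "-1"] exI[of _ 1]) auto
  qed
  from tight_imp_convergent_subsubsequence[OF this strict_mono_id]
  obtain r M where r: "strict_mono r" and M: "real_distribution M" and wc: "weak_conv_m (\<mu> \<circ> id \<circ> r) M"
    by auto
  interpret M: real_distribution M by fact
  have conv: "(\<lambda>n. \<integral>x. f (cantor_number (b x)) \<partial>N (r n)) \<longlonglongrightarrow> (\<integral>y. f y \<partial>M)"
    if f: "\<And>y. isCont f y" and B: "\<And>y. norm (f y) \<le> B" for f :: "real \<Rightarrow> real" and B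
  proof -
    have [measurable]: "f \<in> borel_measurable borel"
      by (intro borel_measurable_continuous_onI continuous_at_imp_continuous_on ballI f)
    have "(\<lambda>n. integral\<^sup>L ((\<mu> \<circ> id \<circ> r) n) f) \<longlonglongrightarrow> integral\<^sup>L M f"
      by (rule weak_conv_imp_integral_bdd_continuous_conv[OF _ M wc f B]) (use rd in auto)
    also have "(\<lambda>n. integral\<^sup>L ((\<mu> \<circ> id \<circ> r) n) f) = (\<lambda>n. \<integral>x. f (cantor_number (b x)) \<partial>N (r n))"
      unfolding \<mu>_def comp_def id_def by (intro ext integral_distr) measurable
    finally show ?thesis .
  qed
  have "AE y in M. cantor_digit i y \<in> {0, 1}" for i
  proof -
    let ?f = "\<lambda>y. cantor_digit i y * (1 - cantor_digit i y)"
    have bd: "norm (?f y) \<le> 1" "0 \<le> ?f y" for y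
      using cantor_digit_range[of i y] by (auto simp: abs_mult intro!: mult_le_one)
    have "(\<lambda>n. \<integral>x. ?f (cantor_number (b x)) \<partial>N (r n)) \<longlonglongrightarrow> (\<integral>y. ?f y \<partial>M)"
      using bd by (intro conv[of ?f 1]) (auto intro!: continuous_intros)
    moreover have "of_bool P * (1 - of_bool P) = (0::real)" for P by simp
    ultimately have "(\<integral>y. ?f y \<partial>M) = 0"
      by (simp add: cantor_digit_cantor_number LIMSEQ_const_iff)
    moreover have "integrable M ?f"
      using bd by (intro M.integrable_const_bound[where B = 1]) auto
    ultimately have "AE y in M. ?f y = 0"
      using bd by (subst (asm) integral_nonneg_eq_0_iff_AE) auto
    then show ?thesis by eventually_elim auto
  qed
  then have "AE y in M. \<forall>i. cantor_digit i y \<in> {0, 1}"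
    by (simp add: AE_all_countable)
  with r M conv show ?thesis by (rule that)
qed

section \<open>Coding a Polish space by bits\<close>

lemma dense_sequence_exists:
  obtains q :: "nat \<Rightarrow> 'a::polish_space" where "\<And>x e. 0 < e \<Longrightarrow> \<exists>i. dist (q i) x < e"
proof -
  obtain D :: "'a set" where D: "countable D" "\<And>X. open X \<Longrightarrow> X \<noteq> {} \<Longrightarrow> \<exists>d\<in>D. d \<in> X"
    using countable_dense_setE by blast
  have "\<exists>i. dist (from_nat_into D i) x < e" if "0 < e" for x e
  proof -
    obtain d where d: "d \<in> D" "d \<in> ball x e" using D(2)[of "ball x e"] \<open>0 < e\<close> by auto
    obtain i where "d = from_nat_into D i" using from_nat_into_surj[OF D(1) d(1)] by auto
    with d(2) show ?thesis by (auto simp: dist_commute)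
  qed
  then show ?thesis by (rule that)
qed

text \<open>
  A Polish space is a measurable retract of the space of bit sequences.  The bits of a point record
  which balls around a dense sequence contain it.  A point is recovered as the limit of the first
  centers found at each of the scales \<open>1, 1/2, 1/3, \<dots>\<close>.  Decoding is a measurable left inverse
  defined on all bit sequences, so measures on bit sequences can be transported back to the space.
  The balls form a base of the topology, which makes open boxes in a power of the space visible to
  finitely many bits.
\<close>

lemma polish_coding_exists:
  obtains U :: "nat \<Rightarrow> 'a::polish_space set" and dec :: "(nat \<Rightarrow> bool) \<Rightarrow> 'a"
  where "\<And>j. open (U j)" "\<And>x S. open S \<Longrightarrow> x \<in> S \<Longrightarrow> \<exists>j. x \<in> U j \<and> U j \<subseteq> S"
    "dec \<in> measurable (\<Pi>\<^sub>M j\<in>UNIV. count_space UNIV) borel" "\<And>x. dec (\<lambda>j. x \<in> U j) = x"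
proof -
  obtain q :: "nat \<Rightarrow> 'a" where q: "\<And>x e. 0 < e \<Longrightarrow> \<exists>i. dist (q i) x < e"
    by (rule dense_sequence_exists) blast
  define U where "U j = (case prod_decode j of (m, i) \<Rightarrow> ball (q i) (1 / real (Suc m)))" for j
  have U_enc: "U (prod_encode (m, i)) = ball (q i) (1 / real (Suc m))" for m i
    by (simp add: U_def)
  define idx where "idx b m = (LEAST i. b (prod_encode (m, i)))" for b :: "nat \<Rightarrow> bool" and m
  \<comment> \<open>If the centers do not converge the sequence is made constant, so that decoding is a limit everywhere.\<close>
  define ap where "ap b m = (if Cauchy (\<lambda>m. q (idx b m)) then q (idx b m) else q 0)" for b m
  define dec where "dec b = lim (ap b)" for b
  let ?\<Omega> = "\<Pi>\<^sub>M j\<in>(UNIV::nat set). count_space (UNIV :: bool set)"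
  have [measurable]: "(\<lambda>b. idx b m) \<in> measurable ?\<Omega> (count_space UNIV)" for m
    unfolding idx_def by measurable
  have [measurable]: "(\<lambda>b. q (idx b m)) \<in> borel_measurable ?\<Omega>" for m
    by measurable
  have conv: "(\<lambda>m. ap b m) \<longlonglongrightarrow> dec b" for b
  proof -
    have "Cauchy (ap b)"
      by (cases "Cauchy (\<lambda>m. q (idx b m))") (simp_all add: ap_def[abs_def] convergent_Cauchy convergent_const)
    then show ?thesis
      unfolding dec_def by (simp add: Cauchy_convergent_iff convergent_LIMSEQ_iff)
  qed
  have "dec \<in> borel_measurable ?\<Omega>"
    by (rule borel_measurable_LIMSEQ_metric[where f = "\<lambda>m b. ap b m"])
      (auto simp: ap_def intro!: measurable_If conv[unfolded ap_def])
  moreover have "dec (\<lambda>j. x \<in> U j) = x" for x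
  proof -
    let ?b = "\<lambda>j. x \<in> U j"
    have "dist (q (idx ?b m)) x < 1 / real (Suc m)" for m
    proof -
      obtain i where "dist (q i) x < 1 / real (Suc m)" using q[of "1 / real (Suc m)" x] by auto
      then have "?b (prod_encode (m, i))" by (simp add: U_enc)
      then have "?b (prod_encode (m, idx ?b m))" unfolding idx_def by (rule LeastI)
      then show ?thesis by (simp add: U_enc)
    qed
    then have "(\<lambda>m. q (idx ?b m)) \<longlonglongrightarrow> x"
      by (intro metric_tendsto_imp_tendsto[OF LIMSEQ_inverse_real_of_nat always_eventually])
        (auto intro!: less_imp_le simp: inverse_eq_divide)
    then have "(\<lambda>m. ap ?b m) \<longlonglongrightarrow> x"
      by (simp add: ap_def LIMSEQ_imp_Cauchy)
    then show ?thesis using conv LIMSEQ_unique by blast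
  qed
  moreover have "\<exists>j. x \<in> U j \<and> U j \<subseteq> S" if S: "open S" "x \<in> S" for x S
  proof -
    obtain e where e: "e > 0" "ball x e \<subseteq> S" using S openE by blast
    obtain m where m: "1 / real (Suc m) < e / 2"
      using reals_Archimedean[of "e/2"] e by (auto simp: inverse_eq_divide)
    obtain i where i: "dist (q i) x < 1 / real (Suc m)" using q[of "1 / real (Suc m)" x] by auto
    have "ball (q i) (1 / real (Suc m)) \<subseteq> ball x e"
    proof
      fix z assume "z \<in> ball (q i) (1 / real (Suc m))"
      then have "dist x z < 1 / real (Suc m) + 1 / real (Suc m)"
        using i dist_triangle[of x z "q i"] by (auto simp: dist_commute)
      then have "dist x z < e" using m by linarith
      then show "z \<in> ball x e" by simp
    qed
    with e i show ?thesis by (intro exI[of _ "prod_encode (m, i)"]) (auto simp: U_enc)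
  qed
  ultimately show ?thesis
    by (intro that[of U dec]) (auto simp: U_def split: prod.split)
qed

section \<open>Lower semicontinuous costs and couplings\<close>

text \<open>
  Sequential lower semicontinuity for the product topology on the extensional functions, whose
  convergence is that of the first \<open>K\<close> coordinates.
\<close>

definition seq_lsc :: "nat \<Rightarrow> ((nat \<Rightarrow> 'a::polish_space) \<Rightarrow> real) \<Rightarrow> bool" where
  "seq_lsc K c \<longleftrightarrow> (\<forall>x\<in>space (borel_pow K). \<forall>u.
     (\<forall>n. u n \<in> space (borel_pow K)) \<longrightarrow> (\<forall>k<K. (\<lambda>n. u n k) \<longlonglongrightarrow> x k) \<longrightarrow>
     (\<forall>a<c x. \<forall>\<^sub>F n in sequentially. a < c (u n)))"

text \<open>
  A nonnegative lower semicontinuous function is the supremum of countably many step functions,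
  each a rational constant on a box of basic open sets.  All pairs of a rational and a box are
  enumerated; a pair contributes only if its constant is a lower bound for \<open>c\<close> on its box.
\<close>

lemma seq_lsc_eq_SUP_boxes:
  fixes U :: "nat \<Rightarrow> 'a::polish_space set"
  assumes U: "\<And>x S. open S \<Longrightarrow> x \<in> S \<Longrightarrow> \<exists>j. x \<in> U j \<and> U j \<subseteq> S"
    and lsc: "seq_lsc K c" and c0: "\<And>x. x \<in> space (borel_pow K) \<Longrightarrow> 0 \<le> c x"
  obtains t :: "nat \<Rightarrow> real" and s :: "nat \<Rightarrow> nat \<Rightarrow> nat"
  where "\<And>l. 0 \<le> t l"
    "\<And>x. x \<in> space (borel_pow K) \<Longrightarrow>
       ennreal (c x) = (SUP l. ennreal (t l * of_bool (\<forall>k<K. x k \<in> U (s l k))))"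
proof -
  define s where "s l k = snd (from_nat l :: rat \<times> nat list) ! k" for l k
  define t0 where "t0 l = (of_rat (fst (from_nat l :: rat \<times> nat list)) :: real)" for l
  define ok where "ok l \<longleftrightarrow> 0 \<le> t0 l \<and>
    (\<forall>x\<in>space (borel_pow K). (\<forall>k<K. x k \<in> U (s l k)) \<longrightarrow> t0 l \<le> c x)" for l
  define t where "t l = (if ok l then t0 l else 0)" for l
  have t_nonneg: "0 \<le> t l" for l
    by (auto simp: t_def ok_def)
  have t_le: "t l \<le> c x" if "x \<in> space (borel_pow K)" "\<forall>k<K. x k \<in> U (s l k)" for l x
    using that c0 by (auto simp: t_def ok_def)
  have approx: "\<exists>l. a < t l \<and> (\<forall>k<K. x k \<in> U (s l k))"
    if x: "x \<in> space (borel_pow K)" and a: "0 \<le> a" "a < c x" for x a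
  proof -
    obtain q where q: "a < of_rat q" "of_rat q < c x" using of_rat_dense[OF a(2)] by blast
    have "\<exists>n. \<forall>x'\<in>space (borel_pow K). (\<forall>k<K. x' k \<in> ball (x k) (1 / real (Suc n))) \<longrightarrow> of_rat q < c x'"
    proof (rule ccontr)
      assume "\<not> ?thesis"
      then have "\<exists>u. \<forall>n. u n \<in> space (borel_pow K) \<and>
          (\<forall>k<K. u n k \<in> ball (x k) (1 / real (Suc n))) \<and> c (u n) \<le> of_rat q"
        by (intro choice) (simp add: not_less Bex_def)
      then obtain u where u: "\<And>n. u n \<in> space (borel_pow K)"
        "\<And>n k. k < K \<Longrightarrow> u n k \<in> ball (x k) (1 / real (Suc n))" "\<And>n. c (u n) \<le> of_rat q"
        by blast
      have "(\<lambda>n. u n k) \<longlonglongrightarrow> x k" if "k < K" for k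
        using u(2)[OF that]
        by (intro metric_tendsto_imp_tendsto[OF LIMSEQ_inverse_real_of_nat always_eventually])
          (auto intro!: less_imp_le simp: inverse_eq_divide dist_commute)
      with lsc x u(1) q(2) have "\<forall>\<^sub>F n in sequentially. of_rat q < c (u n)"
        unfolding seq_lsc_def by blast
      then obtain n where "of_rat q < c (u n)" by (auto simp: eventually_sequentially)
      with u(3)[of n] show False by simp
    qed
    then obtain n where n: "\<And>x'. x' \<in> space (borel_pow K) \<Longrightarrow>
        (\<And>k. k < K \<Longrightarrow> x' k \<in> ball (x k) (1 / real (Suc n))) \<Longrightarrow> of_rat q < c x'"
      by blast
    have "\<forall>k. \<exists>j. x k \<in> U j \<and> U j \<subseteq> ball (x k) (1 / real (Suc n))"
      by (intro allI U) auto
    then obtain j where j: "\<And>k. x k \<in> U (j k)" "\<And>k. U (j k) \<subseteq> ball (x k) (1 / real (Suc n))"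
      by metis
    define l where "l = to_nat (q, map j [0..<K])"
    have s_l: "s l k = j k" if "k < K" for k using that by (simp add: s_def l_def)
    have "t0 l = of_rat q" by (simp add: t0_def l_def)
    moreover have "ok l"
      unfolding ok_def
    proof (intro conjI ballI impI)
      show "0 \<le> t0 l" unfolding \<open>t0 l = of_rat q\<close> using q(1) a(1) by linarith
      fix x' assume "x' \<in> space (borel_pow K)" "\<forall>k<K. x' k \<in> U (s l k)"
      then show "t0 l \<le> c x'"
        using n[of x'] j(2) s_l \<open>t0 l = of_rat q\<close> by (fastforce intro: less_imp_le)
    qed
    ultimately show ?thesis
      using q j(1) s_l by (intro exI[of _ l]) (simp add: t_def)
  qed
  show ?thesis
  proof (rule that[of t s])
    fix x :: "nat \<Rightarrow> 'a" assume x: "x \<in> space (borel_pow K)"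
    let ?g = "\<lambda>l. ennreal (t l * of_bool (\<forall>k<K. x k \<in> U (s l k)))"
    show "ennreal (c x) = (SUP l. ?g l)"
    proof (rule antisym)
      show "(SUP l. ?g l) \<le> ennreal (c x)"
        using t_le[OF x] c0[OF x] by (intro SUP_least ennreal_leI) auto
      show "ennreal (c x) \<le> (SUP l. ?g l)"
      proof (rule ccontr)
        assume "\<not> ?thesis"
        then have less: "(SUP l. ?g l) < ennreal (c x)" by simp
        then obtain a where a: "0 \<le> a" "(SUP l. ?g l) = ennreal a"
          by (cases "SUP l. ?g l") auto
        with less have "a < c x" by (simp add: ennreal_less_iff)
        from approx[OF x a(1) this] obtain l where l: "a < t l" "\<forall>k<K. x k \<in> U (s l k)" by blast
        have "?g l \<le> ennreal a" unfolding a(2)[symmetric] by (rule SUP_upper) simp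
        with l a(1) t_nonneg[of l] show False by (simp add: ennreal_le_iff)
      qed
    qed
  qed (rule t_nonneg)
qed

lemma borel_measurable_seq_lsc:
  fixes c :: "(nat \<Rightarrow> 'a::polish_space) \<Rightarrow> real"
  assumes lsc: "seq_lsc K c" and c0: "\<And>x. x \<in> space (borel_pow K) \<Longrightarrow> 0 \<le> c x"
  shows "(\<lambda>x. ennreal (c x)) \<in> borel_measurable (borel_pow K)"
proof -
  obtain U :: "nat \<Rightarrow> 'a set" and dec :: "(nat \<Rightarrow> bool) \<Rightarrow> 'a"
    where U: "\<And>j. open (U j)" "\<And>x S. open S \<Longrightarrow> x \<in> S \<Longrightarrow> \<exists>j. x \<in> U j \<and> U j \<subseteq> S"
      and "dec \<in> measurable (\<Pi>\<^sub>M j\<in>UNIV. count_space UNIV) borel" "\<And>x. dec (\<lambda>j. x \<in> U j) = x"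
    by (rule polish_coding_exists) blast
  obtain t :: "nat \<Rightarrow> real" and s :: "nat \<Rightarrow> nat \<Rightarrow> nat"
    where "\<And>l. 0 \<le> t l" and ts: "\<And>x. x \<in> space (borel_pow K) \<Longrightarrow>
       ennreal (c x) = (SUP l. ennreal (t l * of_bool (\<forall>k<K. x k \<in> U (s l k))))"
    by (rule seq_lsc_eq_SUP_boxes[OF U(2) lsc c0]) blast+
  have [measurable]: "U j \<in> sets borel" for j using U(1) by simp
  have "(\<lambda>x. SUP l. ennreal (t l * of_bool (\<forall>k<K. x k \<in> U (s l k)))) \<in> borel_measurable (borel_pow K)"
  proof (intro borel_measurable_SUP)
    fix l
    have "Measurable.pred (borel_pow K) (\<lambda>x. x k \<in> U j)" if "k < K" for k j
    proof -
      have [measurable]: "(\<lambda>x. x k) \<in> measurable (borel_pow K) (borel :: 'a measure)"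
        using that by (intro measurable_component_singleton) simp
      show ?thesis by measurable
    qed
    then have [measurable]: "Measurable.pred (borel_pow K) (\<lambda>x. \<forall>k\<in>{..<K}. x k \<in> U (s l k))"
      by (intro pred_intros_finite) auto
    have "(\<lambda>x. ennreal (t l * of_bool (\<forall>k\<in>{..<K}. x k \<in> U (s l k)))) \<in> borel_measurable (borel_pow K)"
      by (simp add: of_bool_def) measurable
    then show "(\<lambda>x. ennreal (t l * of_bool (\<forall>k<K. x k \<in> U (s l k)))) \<in> borel_measurable (borel_pow K)"
      by (simp add: Ball_def)
  qed simp
  then show ?thesis by (subst measurable_cong[OF ts]) auto
qed

lemma product_coupling:
  assumes \<mu>: "\<And>k. k < K \<Longrightarrow> \<mu> k \<in> borel_probs"
  shows "Pi\<^sub>M {..<K} \<mu> \<in> couplings K \<mu>"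
proof -
  have p: "k < K \<Longrightarrow> prob_space (\<mu> k)" and s: "k < K \<Longrightarrow> sets (\<mu> k) = sets borel" for k
    using \<mu> by (auto simp: borel_probs_def)
  have "distr (Pi\<^sub>M {..<K} \<mu>) borel (\<lambda>x. x k) = \<mu> k" if "k < K" for k
  proof -
    have "distr (Pi\<^sub>M {..<K} \<mu>) borel (\<lambda>x. x k) = distr (Pi\<^sub>M {..<K} \<mu>) (\<mu> k) (\<lambda>x. x k)"
      using s[OF that] by (intro distr_cong) auto
    also have "\<dots> = \<mu> k" using p that by (intro distr_PiM_component) auto
    finally show ?thesis .
  qed
  then show ?thesis
    unfolding couplings_def using p s by (auto intro!: prob_space_PiM sets_PiM_cong)
qed

lemma couplingsD:
  assumes "\<gamma> \<in> couplings K \<mu>"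
  shows "prob_space \<gamma>" "sets \<gamma> = sets (borel_pow K)" "space \<gamma> = space (borel_pow K)"
    "\<And>k. k < K \<Longrightarrow> distr \<gamma> borel (\<lambda>x. x k) = \<mu> k"
    "\<And>k. k < K \<Longrightarrow> (\<lambda>x. x k) \<in> measurable \<gamma> borel"
proof -
  show s: "sets \<gamma> = sets (borel_pow K)" and "prob_space \<gamma>"
    and "\<And>k. k < K \<Longrightarrow> distr \<gamma> borel (\<lambda>x. x k) = \<mu> k"
    using assms by (auto simp: couplings_def)
  show "space \<gamma> = space (borel_pow K)" using s by (rule sets_eq_imp_space_eq)
  show "(\<lambda>x. x k) \<in> measurable \<gamma> borel" if "k < K" for k
    unfolding measurable_cong_sets[OF s refl] using that by (intro measurable_component_singleton) simp
qed

lemma couplingsI: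
  assumes "prob_space \<gamma>" "sets \<gamma> = sets (borel_pow K)" "\<And>k. k < K \<Longrightarrow> distr \<gamma> borel (\<lambda>x. x k) = \<mu> k"
  shows "\<gamma> \<in> couplings K \<mu>"
  using assms by (simp add: couplings_def)

section \<open>Existence of optimal couplings\<close>

text \<open>
  The direct method.  A minimising sequence of couplings is pushed to the real line by coding all
  coordinates of a point into one Cantor number, and a weakly convergent subsequence is chosen.
  The limit \<open>M\<close> is decoded back to the power of the space.
  
  Decoding could fail on bit sequences that are not codes.  The marginals prevent this:
  finite-dimensional distributions pass to the limit, so the bits of the \<open>k\<close>-th coordinate have under
  \<open>M\<close> the law of the code of a point drawn from \<open>\<mu> k\<close>, and a code survives decoding and re-coding.
  So \<open>M\<close> is carried by codes, and the decoded measure has the right marginals.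
  
  The cost is a supremum of step functions on basic boxes, hence an increasing limit of continuous
  functions of finitely many bits.  The integral of each of these is a limit of
  integrals bounded by the costs of the minimising sequence, and monotone convergence gives the bound
  for the cost itself.
\<close>

theorem optimal_coupling_exists:
  fixes \<mu> :: "nat \<Rightarrow> 'a::polish_space measure"
  assumes \<mu>: "\<And>k. k < K \<Longrightarrow> \<mu> k \<in> borel_probs"
    and lsc: "seq_lsc K c" and c0: "\<And>x. x \<in> space (borel_pow K) \<Longrightarrow> 0 \<le> c x"
  obtains \<gamma> where "\<gamma> \<in> couplings K \<mu>"
    "\<And>\<gamma>'. \<gamma>' \<in> couplings K \<mu> \<Longrightarrow> (\<integral>\<^sup>+x. ennreal (c x) \<partial>\<gamma>) \<le> (\<integral>\<^sup>+x. ennreal (c x) \<partial>\<gamma>')"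
proof -
  let ?cost = "\<lambda>\<gamma>. \<integral>\<^sup>+x. ennreal (c x) \<partial>\<gamma>"
  let ?I = "INF \<gamma>\<in>couplings K \<mu>. ?cost \<gamma>"
  have "couplings K \<mu> \<noteq> {}"
    using product_coupling[of K \<mu>, OF \<mu>] by blast
  then have "\<exists>v. (\<forall>n. v n \<in> ?cost ` couplings K \<mu>) \<and> v \<longlonglongrightarrow> ?I"
    by (intro Inf_as_limit) simp
  then obtain v where v: "\<And>n. v n \<in> ?cost ` couplings K \<mu>" "v \<longlonglongrightarrow> ?I" by blast
  then have "\<exists>g. \<forall>n. g n \<in> couplings K \<mu> \<and> v n = ?cost (g n)"
    by (intro choice) auto
  then obtain g where g: "\<And>n. g n \<in> couplings K \<mu>" and v_eq: "\<And>n. v n = ?cost (g n)" by blast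
  note gD = couplingsD[OF g]
  note [measurable_cong] = gD(2)
  obtain U :: "nat \<Rightarrow> 'a set" and dec
    where U: "\<And>j. open (U j)" "\<And>x S. open S \<Longrightarrow> x \<in> S \<Longrightarrow> \<exists>j. x \<in> U j \<and> U j \<subseteq> S"
      and dec [measurable]: "dec \<in> measurable (\<Pi>\<^sub>M j\<in>UNIV. count_space UNIV) borel"
      and dec_code: "\<And>x. dec (\<lambda>j. x \<in> U j) = x"
    by (rule polish_coding_exists) blast
  have [measurable]: "U j \<in> sets borel" for j using U(1) by simp
  obtain t :: "nat \<Rightarrow> real" and s :: "nat \<Rightarrow> nat \<Rightarrow> nat"
    where t_nonneg: "\<And>l. 0 \<le> t l" and c_eq: "\<And>x. x \<in> space (borel_pow K) \<Longrightarrow>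
       ennreal (c x) = (SUP l. ennreal (t l * of_bool (\<forall>k<K. x k \<in> U (s l k))))"
    by (rule seq_lsc_eq_SUP_boxes[OF U(2) lsc c0]) blast+

  define b where "b x i = (case prod_decode i of (k, j) \<Rightarrow> k < K \<and> x k \<in> U j)" for x :: "nat \<Rightarrow> 'a" and i
  have b_enc: "b x (prod_encode (k, j)) \<longleftrightarrow> x k \<in> U j" if "k < K" for x k j
    using that by (simp add: b_def)
  have b_meas: "Measurable.pred (g n) (\<lambda>x. b x i)" for n i
  proof -
    obtain k j where i: "prod_decode i = (k, j)" by (cases "prod_decode i")
    show ?thesis
    proof (cases "k < K")
      case True
      then have [measurable]: "(\<lambda>x. x k) \<in> measurable (g n) borel" by (rule gD)
      show ?thesis using True by (simp add: b_def i)
    qed (simp add: b_def i)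
  qed
  obtain r M where r: "strict_mono r" and M: "real_distribution M"
    and conv: "\<And>f B. (\<And>y. isCont f y) \<Longrightarrow> (\<And>y. norm (f y) \<le> B) \<Longrightarrow>
       (\<lambda>n. \<integral>x. f (cantor_number (b x)) \<partial>g (r n)) \<longlonglongrightarrow> (\<integral>y. f y \<partial>M :: real)"
    and M01: "AE y in M. \<forall>i. cantor_digit i y \<in> {0, 1}"
    by (rule cantor_compactness[where N = g and b = b, OF gD(1) b_meas]) blast+
  interpret M: real_distribution M by fact

  define dig where "dig k j y = cantor_digit (prod_encode (k, j)) y" for k j y
  have dig_cont: "isCont (\<lambda>y. dig k j y) y" for k j y
    unfolding dig_def by (rule isCont_cantor_digit)
  have [measurable]: "dig k j \<in> borel_measurable borel" for k j
    unfolding dig_def[abs_def] by simp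
  have dig_range: "0 \<le> dig k j y" "dig k j y \<le> 1" for k j y
    by (simp_all add: dig_def cantor_digit_range)
  have dig_b: "dig k j (cantor_number (b x)) = of_bool (x k \<in> U j)" if "k < K" for k j x
    using that by (simp add: dig_def cantor_digit_cantor_number b_enc)
  define bits where "bits k y j \<longleftrightarrow> dig k j y = 1" for k y j
  define pt where "pt y = (\<lambda>k\<in>{..<K}. dec (bits k y))" for y
  let ?\<Omega> = "\<Pi>\<^sub>M j\<in>(UNIV::nat set). count_space (UNIV :: bool set)"
  have bits_meas [measurable]: "bits k \<in> measurable borel ?\<Omega>" for k
    unfolding bits_def[abs_def] by (rule measurable_abs_UNIV) measurable
  have code_meas [measurable]: "(\<lambda>x j. x \<in> U j) \<in> measurable borel ?\<Omega>"
    by (rule measurable_abs_UNIV) measurable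
  have pt_meas [measurable]: "pt \<in> measurable borel (borel_pow K)"
    unfolding pt_def[abs_def] by (intro measurable_restrict) measurable
  have M01': "AE y in M. \<forall>k j. dig k j y = of_bool (bits k y j)"
    using M01 by eventually_elim (auto simp: bits_def dig_def)

  \<comment> \<open>Cylinder probabilities are limits along the couplings, which all have the marginal \<open>\<mu> k\<close>.\<close>
  have law: "distr M ?\<Omega> (bits k) = distr (\<mu> k) ?\<Omega> (\<lambda>x j. x \<in> U j)" if k: "k < K" for k
  proof -
    have \<mu>k: "prob_space (\<mu> k)" and [measurable_cong, simp]: "sets (\<mu> k) = sets borel"
      using \<mu>[OF k] by (auto simp: borel_probs_def)
    interpret \<mu>k: prob_space "\<mu> k" by fact
    have code_k: "(\<lambda>x j. x \<in> U j) \<in> measurable (\<mu> k) ?\<Omega>" by measurable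
    show ?thesis
    proof (rule measure_eqI_PiM_infinite)
      show "finite_measure (distr M ?\<Omega> (bits k))"
        by (intro prob_space.finite_measure M.prob_space_distr) measurable
      fix J :: "nat set" and A :: "nat \<Rightarrow> bool set" assume J: "finite J"
      define P where "P p \<longleftrightarrow> (\<forall>j\<in>J. p j \<in> A j)" for p
      have emb: "prod_emb UNIV (\<lambda>_. count_space UNIV) J (Pi\<^sub>E J A) = {p\<in>space ?\<Omega>. P p}"
        by (auto simp: prod_emb_def P_def space_PiM restrict_PiE_iff)
      have [measurable]: "Measurable.pred ?\<Omega> P"
        unfolding P_def[abs_def] using J by measurable
      have "Measurable.pred borel (\<lambda>x. P (\<lambda>j. x \<in> U j))"
        by (rule measurable_compose[OF code_meas]) measurable
      then have ind_meas: "(\<lambda>x. of_bool (P (\<lambda>j. x \<in> U j)) :: real) \<in> borel_measurable borel"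
        unfolding of_bool_def by measurable
      \<comment> \<open>A continuous function of finitely many digits that equals the indicator of the cylinder on bits.\<close>
      let ?f = "\<lambda>y. \<Prod>j\<in>J. of_bool (True \<in> A j) * dig k j y + of_bool (False \<in> A j) * (1 - dig k j y)"
      have f01: "0 \<le> ?f y" "?f y \<le> 1" for y
        using dig_range[of k _ y] by (auto intro!: prod_nonneg prod_le_1)
      have prodP: "(\<Prod>j\<in>J. of_bool (True \<in> A j) * of_bool (p j) + of_bool (False \<in> A j) * (1 - of_bool (p j)))
          = (of_bool (P p) :: real)" for p
      proof -
        have "(\<Prod>j\<in>J. of_bool (True \<in> A j) * of_bool (p j) + of_bool (False \<in> A j) * (1 - of_bool (p j)))
          = (\<Prod>j\<in>J. of_bool (p j \<in> A j) :: real)"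
          by (intro prod.cong refl) (case_tac "p x"; simp)
        also have "\<dots> = of_bool (P p)"
          using J unfolding P_def by (induction J rule: finite_induct) auto
        finally show ?thesis .
      qed
      have "(\<lambda>n. \<integral>x. ?f (cantor_number (b x)) \<partial>g (r n)) \<longlonglongrightarrow> (\<integral>y. ?f y \<partial>M)"
        using f01 dig_cont by (intro conv[of ?f 1]) (auto intro!: continuous_intros)
      moreover have "(\<integral>x. ?f (cantor_number (b x)) \<partial>g n) = measure (\<mu> k) {x. P (\<lambda>j. x \<in> U j)}" for n
      proof -
        have "(\<integral>x. ?f (cantor_number (b x)) \<partial>g n) = (\<integral>x. of_bool (P (\<lambda>j. x k \<in> U j)) \<partial>g n)"
          by (simp add: dig_b[OF k] prodP)
        also have "\<dots> = (\<integral>x. of_bool (P (\<lambda>j. x \<in> U j)) \<partial>distr (g n) borel (\<lambda>x. x k))"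
          by (rule integral_distr[OF gD(5)[OF k] ind_meas, symmetric])
        also have "\<dots> = (\<integral>x. indicator {x. P (\<lambda>j. x \<in> U j)} x \<partial>\<mu> k)"
          unfolding gD(4)[OF k] by (intro Bochner_Integration.integral_cong) (auto simp: indicator_def)
        finally show ?thesis by simp
      qed
      ultimately have "(\<integral>y. ?f y \<partial>M) = measure (\<mu> k) {x. P (\<lambda>j. x \<in> U j)}"
        by (simp add: LIMSEQ_const_iff)
      also have "(\<integral>y. ?f y \<partial>M) = (\<integral>y. indicator {y. P (bits k y)} y \<partial>M)"
      proof (intro integral_cong_AE)
        show "AE y in M. ?f y = indicator {y. P (bits k y)} y"
          using M01' by eventually_elim (simp add: prodP indicator_def)
      qed measurable
      finally have eq: "measure M {y. P (bits k y)} = measure (\<mu> k) {x. P (\<lambda>j. x \<in> U j)}"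
        by simp
      have "emeasure (distr M ?\<Omega> (bits k)) {p\<in>space ?\<Omega>. P p} = emeasure M {y. P (bits k y)}"
        using measurable_space[OF bits_meas[of k]] by (subst emeasure_distr) (auto intro!: arg_cong[where f = "emeasure M"])
      also have "\<dots> = emeasure (\<mu> k) {x. P (\<lambda>j. x \<in> U j)}"
        by (simp add: M.emeasure_eq_measure \<mu>k.emeasure_eq_measure eq)
      also have "\<dots> = emeasure (distr (\<mu> k) ?\<Omega> (\<lambda>x j. x \<in> U j)) {p\<in>space ?\<Omega>. P p}"
        using measurable_space[OF code_meas] sets_eq_imp_space_eq[OF \<open>sets (\<mu> k) = sets borel\<close>]
        by (subst emeasure_distr[OF code_k]) (auto intro!: arg_cong[where f = "emeasure (\<mu> k)"])
      finally show "emeasure (distr M ?\<Omega> (bits k)) (prod_emb UNIV (\<lambda>_. count_space UNIV) J (Pi\<^sub>E J A)) =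
          emeasure (distr (\<mu> k) ?\<Omega> (\<lambda>x j. x \<in> U j)) (prod_emb UNIV (\<lambda>_. count_space UNIV) J (Pi\<^sub>E J A))"
        unfolding emb .
    qed simp_all
  qed

  \<comment> \<open>Re-coding the decoded point gives back its bits, since this holds for the law of a code.\<close>
  have faithful: "AE y in M. \<forall>k<K. \<forall>j. bits k y j \<longleftrightarrow> pt y k \<in> U j"
  proof -
    have "AE y in M. k < K \<longrightarrow> (\<forall>j. bits k y j \<longleftrightarrow> pt y k \<in> U j)" for k
    proof (cases "k < K")
      case k: True
      have [measurable_cong]: "sets (\<mu> k) = sets borel" using \<mu>[OF k] by (auto simp: borel_probs_def)
      have "AE p in distr (\<mu> k) ?\<Omega> (\<lambda>x j. x \<in> U j). \<forall>j. p j \<longleftrightarrow> dec p \<in> U j"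
        by (subst AE_distr_iff) (measurable, simp add: dec_code)
      then have "AE y in M. \<forall>j. bits k y j \<longleftrightarrow> dec (bits k y) \<in> U j"
        unfolding law[OF k, symmetric] by (rule AE_distrD[rotated]) measurable
      then show ?thesis by eventually_elim (use k in \<open>simp add: pt_def\<close>)
    qed simp
    then show ?thesis by (simp add: AE_all_countable)
  qed

  define \<gamma> where "\<gamma> = distr M (borel_pow K) pt"
  have "\<gamma> \<in> couplings K \<mu>"
  proof (rule couplingsI)
    show "prob_space \<gamma>" unfolding \<gamma>_def by (intro M.prob_space_distr) measurable
    fix k assume k: "k < K"
    have [measurable_cong, simp]: "sets (\<mu> k) = sets borel" using \<mu>[OF k] by (auto simp: borel_probs_def)
    have "distr \<gamma> borel (\<lambda>x. x k) = distr M borel (\<lambda>y. pt y k)"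
      unfolding \<gamma>_def using k by (subst distr_distr) (auto simp: comp_def)
    also have "\<dots> = distr M borel (\<lambda>y. dec (bits k y))"
      using k by (simp add: pt_def)
    also have "\<dots> = distr (distr M ?\<Omega> (bits k)) borel dec"
      by (subst distr_distr) (auto simp: comp_def)
    also have "\<dots> = distr (\<mu> k) borel (\<lambda>x. x)"
      unfolding law[OF k] by (subst distr_distr) (auto simp: comp_def dec_code)
    also have "\<dots> = \<mu> k" by (rule distr_id2) simp
    finally show "distr \<gamma> borel (\<lambda>x. x k) = \<mu> k" .
  qed (simp add: \<gamma>_def)
  moreover have "?cost \<gamma> \<le> ?I"
  proof -
    define w where "w l y = t l * (\<Prod>k<K. dig k (s l k) y)" for l y
    \<comment> \<open>Running maxima of the step functions, read off the digits: continuous, increasing,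
      and converging to the cost of the decoded point.\<close>
    define V where "V n = rec_nat (\<lambda>_. 0) (\<lambda>l f y. max (f y) (w l y)) n" for n
    have V_simps: "V 0 y = 0" "V (Suc n) y = max (V n y) (w n y)" for n y
      by (simp_all add: V_def)
    have w_nonneg: "0 \<le> w l y" and w_le: "w l y \<le> t l" for l y
      using dig_range t_nonneg by (auto simp: w_def intro!: mult_nonneg_nonneg prod_nonneg mult_left_le prod_le_1)
    have V_nonneg: "0 \<le> V n y" for n y
      by (induction n) (auto simp: V_simps intro: max.coboundedI1)
    have V_le: "V n y \<le> (\<Sum>l<n. t l)" for n y
    proof (induction n)
      case (Suc n)
      have "w n y \<le> (\<Sum>l<Suc n. t l)"
        using w_le[of n y] sum_nonneg[of "{..<n}" t] t_nonneg by simp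
      with Suc t_nonneg[of n] show ?case by (simp add: V_simps)
    qed (simp add: V_simps)
    have V_cont: "isCont (V n) y" for n y
    proof (induction n)
      case 0
      show ?case unfolding V_simps(1)[abs_def] by simp
    next
      case (Suc n)
      show ?case unfolding V_simps(2)[abs_def] w_def
        by (intro continuous_intros Suc dig_cont)
    qed
    have [measurable]: "V n \<in> borel_measurable borel" for n
      by (intro borel_measurable_continuous_onI continuous_at_imp_continuous_on ballI V_cont)
    have V_mono: "V n y \<le> V m y" if "n \<le> m" for n m y
      using that by (induction m rule: dec_induct) (auto simp: V_simps intro: max.coboundedI1)
    have prod_box: "(\<Prod>k<K. of_bool (Q k)) = (of_bool (\<forall>k<K. Q k) :: real)" for Q
      by (induction K) (auto simp: less_Suc_eq)
    have "AE y in M. ennreal (c (pt y)) = (SUP n. ennreal (V n y))"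
      using M01' faithful
    proof eventually_elim
      fix y assume y: "\<forall>k j. dig k j y = of_bool (bits k y j)" "\<forall>k<K. \<forall>j. bits k y j \<longleftrightarrow> pt y k \<in> U j"
      have "pt y \<in> space (borel_pow K)" using measurable_space[OF pt_meas] by simp
      then have "ennreal (c (pt y)) = (SUP l. ennreal (t l * of_bool (\<forall>k<K. pt y k \<in> U (s l k))))"
        by (rule c_eq)
      also have "\<dots> = (SUP l. ennreal (w l y))"
      proof -
        have "(\<Prod>k<K. dig k (s l k) y) = (\<Prod>k<K. of_bool (pt y k \<in> U (s l k)))" for l
          using y by (intro prod.cong) auto
        then show ?thesis by (simp add: w_def prod_box)
      qed
      also have "\<dots> = (SUP n. ennreal (V n y))"
      proof (intro antisym SUP_least)
        show "ennreal (w l y) \<le> (SUP n. ennreal (V n y))" for l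
          by (rule order_trans[OF _ SUP_upper[of "Suc l"]]) (auto simp: V_simps intro: ennreal_leI)
        show "ennreal (V n y) \<le> (SUP l. ennreal (w l y))" for n
        proof (induction n)
          case (Suc n)
          then show ?case by (auto simp: V_simps max_def intro: SUP_upper)
        qed (simp add: V_simps)
      qed
      finally show "ennreal (c (pt y)) = (SUP n. ennreal (V n y))" .
    qed
    then have "(\<integral>\<^sup>+y. ennreal (c (pt y)) \<partial>M) = (\<integral>\<^sup>+y. (SUP n. ennreal (V n y)) \<partial>M)"
      by (rule nn_integral_cong_AE)
    also have "\<dots> = (SUP n. \<integral>\<^sup>+y. ennreal (V n y) \<partial>M)"
      by (intro nn_integral_monotone_convergence_SUP) (auto simp: incseq_def le_fun_def intro!: ennreal_leI V_mono)
    also have "\<dots> \<le> ?I"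
    proof (rule SUP_least)
      fix n
      have bd: "norm (V n y) \<le> (\<Sum>l<n. t l)" for y using V_le V_nonneg by simp
      have "(\<lambda>m. ennreal (\<integral>x. V n (cantor_number (b x)) \<partial>g (r m))) \<longlonglongrightarrow> ennreal (\<integral>y. V n y \<partial>M)"
        by (intro tendsto_ennrealI conv[OF V_cont bd])
      moreover have "ennreal (\<integral>x. V n (cantor_number (b x)) \<partial>g (r m)) \<le> v (r m)" for m
      proof -
        interpret G: prob_space "g (r m)" by (rule gD)
        have [measurable]: "(\<lambda>x. cantor_number (b x)) \<in> borel_measurable (g (r m))"
          by (intro borel_measurable_cantor_number b_meas)
        have "ennreal (\<integral>x. V n (cantor_number (b x)) \<partial>g (r m)) = (\<integral>\<^sup>+x. ennreal (V n (cantor_number (b x))) \<partial>g (r m))"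
          using bd V_nonneg by (intro nn_integral_eq_integral[symmetric] G.integrable_const_bound) auto
        also have "\<dots> \<le> ?cost (g (r m))"
        proof (rule nn_integral_mono)
          fix x assume "x \<in> space (g (r m))"
          then have x: "x \<in> space (borel_pow K)" by (simp add: gD(3))
          have w_x: "ennreal (w l (cantor_number (b x))) \<le> ennreal (c x)" for l
            unfolding c_eq[OF x] w_def by (rule SUP_upper2[of l]) (simp_all add: dig_b prod_box)
          show "ennreal (V n (cantor_number (b x))) \<le> ennreal (c x)"
            by (induction n) (use w_x in \<open>auto simp: V_simps max_def\<close>)
        qed
        finally show ?thesis by (simp add: v_eq)
      qed
      moreover have "(\<lambda>m. v (r m)) \<longlonglongrightarrow> ?I"
        using LIMSEQ_subseq_LIMSEQ[OF v(2) r] by (simp add: comp_def)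
      ultimately have "ennreal (\<integral>y. V n y \<partial>M) \<le> ?I"
        by (intro LIMSEQ_le) auto
      moreover have "(\<integral>\<^sup>+y. ennreal (V n y) \<partial>M) = ennreal (\<integral>y. V n y \<partial>M)"
        using bd V_nonneg by (intro nn_integral_eq_integral M.integrable_const_bound) auto
      ultimately show "(\<integral>\<^sup>+y. ennreal (V n y) \<partial>M) \<le> ?I" by simp
    qed
    finally show ?thesis
      unfolding \<gamma>_def by (subst nn_integral_distr) (use borel_measurable_seq_lsc[OF lsc c0] in auto)
  qed
  ultimately show ?thesis
    by (intro that[of \<gamma>]) (auto intro: order_trans[OF _ INF_lower])
qed

section \<open>Gluing couplings along a common marginal\<close>

text \<open>
  Transport plans are measures on pairs; gluing treats them as marginals, so pairs must form a Polish
  space too.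
\<close>

instance prod :: (polish_space, polish_space) polish_space ..

lemma seq_lsc_of_tendsto:
  assumes "\<And>x u. (\<And>k. k < K \<Longrightarrow> (\<lambda>n. u n k) \<longlonglongrightarrow> x k) \<Longrightarrow> (\<lambda>n. c (u n)) \<longlonglongrightarrow> c x"
  shows "seq_lsc K c"
  unfolding seq_lsc_def by (intro ballI allI impI order_tendstoD(1)[OF assms]) auto

lemma nn_integral_countable_values:
  assumes [measurable]: "idx \<in> measurable M (count_space (UNIV :: nat set))"
  shows "(\<integral>\<^sup>+y. g (idx y) \<partial>M) = (\<Sum>n. g n * emeasure M {y\<in>space M. idx y = n})"
proof -
  have "(\<integral>\<^sup>+y. g (idx y) \<partial>M) = (\<integral>\<^sup>+y. (\<Sum>n. g n * indicator {y\<in>space M. idx y = n} y) \<partial>M)"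
  proof (rule nn_integral_cong)
    fix y assume "y \<in> space M"
    then have "(\<Sum>n. g n * indicator {y\<in>space M. idx y = n} y) = (\<Sum>n\<in>{idx y}. g n * indicator {y\<in>space M. idx y = n} y)"
      by (intro suminf_finite) auto
    with \<open>y \<in> space M\<close> show "g (idx y) = (\<Sum>n. g n * indicator {y\<in>space M. idx y = n} y)" by simp
  qed
  also have "\<dots> = (\<Sum>n. \<integral>\<^sup>+y. g n * indicator {y\<in>space M. idx y = n} y \<partial>M)"
    by (intro nn_integral_suminf) measurable
  also have "\<dots> = (\<Sum>n. g n * emeasure M {y\<in>space M. idx y = n})"
    by (intro suminf_cong nn_integral_cmult_indicator) measurable
  finally show ?thesis .
qed

lemma borel_measurable_fst [measurable]:
  "fst \<in> measurable (borel :: ('a::polish_space \<times> 'b::polish_space) measure) borel"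
  by (intro borel_measurable_continuous_onI continuous_intros)

lemma borel_measurable_snd [measurable]:
  "snd \<in> measurable (borel :: ('a::polish_space \<times> 'b::polish_space) measure) borel"
  by (intro borel_measurable_continuous_onI continuous_intros)

lemma nn_integral_coupling_component:
  assumes "\<gamma> \<in> couplings K \<mu>" "k < K" and [measurable]: "f \<in> borel_measurable borel"
  shows "(\<integral>\<^sup>+x. f (x k) \<partial>\<gamma>) = (\<integral>\<^sup>+y. f y \<partial>\<mu> k)"
proof -
  show ?thesis
    unfolding couplingsD(4)[OF assms(1,2), symmetric]
    by (rule nn_integral_distr[OF couplingsD(5)[OF assms(1,2)], symmetric]) simp
qed

text \<open>
  Partition the common factor into countably many cells in which points are less than \<open>e\<close> apart, choose a cell
  with its \<open>\<nu>\<close>-probability, and then draw all pairs independently from the \<open>\<pi> k\<close> conditioned on their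
  first component lying in the chosen cell.  Averaging the conditional measures over the cells gives
  back \<open>\<pi> k\<close>, and the first components are within \<open>e\<close> of each other because they share a cell.
\<close>

lemma approximate_gluing:
  fixes \<pi> :: "nat \<Rightarrow> ('a::polish_space \<times> 'a) measure"
  assumes \<pi>: "\<And>k. k < N \<Longrightarrow> \<pi> k \<in> borel_probs" "\<And>k. k < N \<Longrightarrow> distr (\<pi> k) borel fst = \<nu>"
    and \<nu>: "\<nu> \<in> borel_probs" and e: "0 < e"
  obtains \<Sigma> where "\<Sigma> \<in> couplings N \<pi>"
    "AE \<omega> in \<Sigma>. \<forall>i<N. \<forall>j<N. dist (fst (\<omega> i)) (fst (\<omega> j)) < e"
proof -
  obtain q :: "nat \<Rightarrow> 'a" where q: "\<And>x e. 0 < e \<Longrightarrow> \<exists>i. dist (q i) x < e"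
    by (rule dense_sequence_exists) blast
  define idx where "idx y = (LEAST i. dist (q i) y < e / 2)" for y
  have idx: "dist (q (idx y)) y < e / 2" for y
    unfolding idx_def by (rule LeastI_ex) (use e in \<open>intro q, simp\<close>)
  have idx_meas [measurable]: "idx \<in> measurable borel (count_space UNIV)"
    unfolding idx_def[abs_def] by measurable
  have [measurable_cong, simp]: "sets \<nu> = sets borel" and [simp]: "space \<nu> = UNIV"
    and "prob_space \<nu>"
    using \<nu> sets_eq_imp_space_eq[of \<nu> borel] by (auto simp: borel_probs_def)
  have idx_\<nu>: "idx \<in> measurable \<nu> (count_space UNIV)" by measurable
  interpret \<nu>: prob_space \<nu> by fact
  define cell where "cell n = {p :: 'a \<times> 'a. idx (fst p) = n}" for n
  have cell_meas [measurable]: "cell n \<in> sets borel" for n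
    unfolding cell_def by measurable
  have \<pi>_sets [simp]: "sets (\<pi> k) = sets borel" and \<pi>_prob: "prob_space (\<pi> k)" if "k < N" for k
    using \<pi>(1)[OF that] by (auto simp: borel_probs_def)
  have \<pi>_cell: "emeasure (\<pi> k) (cell n) = emeasure \<nu> {y. idx y = n}" if k: "k < N" for k n
  proof -
    note [measurable_cong] = \<pi>_sets[OF k]
    have "emeasure \<nu> {y. idx y = n} = emeasure (distr (\<pi> k) borel fst) {y. idx y = n}"
      by (simp add: \<pi>(2)[OF k])
    also have "\<dots> = emeasure (\<pi> k) (fst -` {y. idx y = n} \<inter> space (\<pi> k))"
      by (rule emeasure_distr) measurable
    also have "fst -` {y. idx y = n} \<inter> space (\<pi> k) = cell n"
      using sets_eq_imp_space_eq[OF \<pi>_sets[OF k]] by (auto simp: cell_def)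
    finally show ?thesis by simp
  qed
  \<comment> \<open>On a null cell the choice is arbitrary; \<open>\<pi> k\<close> keeps it a probability measure.\<close>
  define \<kappa> where "\<kappa> k n = (if emeasure \<nu> {y. idx y = n} = 0 then \<pi> k else uniform_measure (\<pi> k) (cell n))" for k n
  have \<kappa>_sets [simp]: "sets (\<kappa> k n) = sets borel" if "k < N" for k n
    using that by (simp add: \<kappa>_def)
  have \<kappa>_prob: "prob_space (\<kappa> k n)" if "k < N" for k n
    using that \<pi>_prob \<pi>_cell \<nu>.emeasure_finite by (auto simp: \<kappa>_def intro!: prob_space_uniform_measure)
  \<comment> \<open>Summing over the cells, weighted by their probabilities, undoes the conditioning.\<close>
  have \<kappa>_mean: "(\<integral>\<^sup>+y. (\<integral>\<^sup>+p. f p \<partial>\<kappa> k (idx y)) \<partial>\<nu>) = (\<integral>\<^sup>+p. f p \<partial>\<pi> k)"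
    if k: "k < N" and f [measurable]: "f \<in> borel_measurable borel" for k f
  proof -
    note [measurable_cong] = \<pi>_sets[OF k]
    have "(\<integral>\<^sup>+y. (\<integral>\<^sup>+p. f p \<partial>\<kappa> k (idx y)) \<partial>\<nu>)
        = (\<Sum>n. (\<integral>\<^sup>+p. f p \<partial>\<kappa> k n) * emeasure \<nu> {y. idx y = n})"
      using nn_integral_countable_values[OF idx_\<nu>, of "\<lambda>n. \<integral>\<^sup>+p. f p \<partial>\<kappa> k n"] by simp
    also have "\<dots> = (\<Sum>n. \<integral>\<^sup>+p. f p * indicator (cell n) p \<partial>\<pi> k)"
    proof (rule suminf_cong)
      fix n
      show "(\<integral>\<^sup>+p. f p \<partial>\<kappa> k n) * emeasure \<nu> {y. idx y = n} = (\<integral>\<^sup>+p. f p * indicator (cell n) p \<partial>\<pi> k)"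
      proof (cases "emeasure \<nu> {y. idx y = n} = 0")
        case True
        then have "AE p in \<pi> k. p \<notin> cell n"
          using \<pi>_cell[OF k] by (intro AE_not_in) (auto simp: null_sets_def k)
        then have "(\<integral>\<^sup>+p. f p * indicator (cell n) p \<partial>\<pi> k) = (\<integral>\<^sup>+p. 0 \<partial>\<pi> k)"
          by (intro nn_integral_cong_AE) auto
        with True show ?thesis by simp
      next
        case False
        have "(\<integral>\<^sup>+p. f p \<partial>\<kappa> k n) = (\<integral>\<^sup>+p. f p * indicator (cell n) p \<partial>\<pi> k) / emeasure \<nu> {y. idx y = n}"
          using False by (simp add: \<kappa>_def nn_integral_uniform_measure \<pi>_cell[OF k])
        with False show ?thesis
          by (simp add: ennreal_divide_times less_top[symmetric])
      qed
    qed
    also have "\<dots> = (\<integral>\<^sup>+p. (\<Sum>n. f p * indicator (cell n) p) \<partial>\<pi> k)"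
      by (rule nn_integral_suminf[symmetric]) measurable
    also have "\<dots> = (\<integral>\<^sup>+p. f p \<partial>\<pi> k)"
    proof (rule nn_integral_cong)
      fix p
      have "(\<Sum>n. f p * indicator (cell n) p) = (\<Sum>n\<in>{idx (fst p)}. f p * indicator (cell n) p)"
        by (intro suminf_finite) (auto simp: cell_def)
      then show "(\<Sum>n. f p * indicator (cell n) p) = f p" by (simp add: cell_def)
    qed
    finally show ?thesis .
  qed
  define P where "P n = Pi\<^sub>M {..<N} (\<lambda>k. \<kappa> k n)" for n
  have P_sets [simp]: "sets (P n) = sets (borel_pow N)" for n
    unfolding P_def by (rule sets_PiM_cong) auto
  have P_prob: "prob_space (P n)" for n
    unfolding P_def by (intro prob_space_PiM \<kappa>_prob) simp
  have "P \<in> measurable (count_space UNIV) (prob_algebra (borel_pow N))"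
    by (auto simp: space_prob_algebra P_prob)
  then have kernel: "(\<lambda>y. P (idx y)) \<in> measurable \<nu> (prob_algebra (borel_pow N))"
    by (rule measurable_compose[rotated]) measurable
  have \<nu>_alg: "\<nu> \<in> space (prob_algebra \<nu>)" by (simp add: space_prob_algebra \<nu>.prob_space_axioms)
  define \<Sigma> where "\<Sigma> = \<nu> \<bind> (\<lambda>y. P (idx y))"
  have \<Sigma>_sets [simp]: "sets \<Sigma> = sets (borel_pow N)"
    unfolding \<Sigma>_def by (rule sets_bind'[OF \<nu>_alg kernel])
  have comp: "(\<lambda>\<omega>. \<omega> k) \<in> measurable (borel_pow N) (borel :: ('a \<times> 'a) measure)" if "k < N" for k
    using that by (intro measurable_component_singleton) simp
  have "\<Sigma> \<in> couplings N \<pi>"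
  proof (rule couplingsI)
    show "prob_space \<Sigma>" unfolding \<Sigma>_def by (rule prob_space_bind'[OF \<nu>_alg kernel])
    fix k assume k: "k < N"
    have comp_\<Sigma>: "(\<lambda>\<omega>. \<omega> k) \<in> measurable \<Sigma> borel"
      using comp[OF k] by (simp cong: measurable_cong_sets)
    have comp_P: "(\<lambda>\<omega>. \<omega> k) \<in> measurable (P n) borel" for n
      using comp[OF k] by (simp cong: measurable_cong_sets)
    show "distr \<Sigma> borel (\<lambda>\<omega>. \<omega> k) = \<pi> k"
    proof (rule measure_eqI)
      fix A assume "A \<in> sets (distr \<Sigma> borel (\<lambda>\<omega>. \<omega> k))"
      then have A [measurable]: "A \<in> sets borel" by simp
      have ind: "(\<lambda>\<omega>. indicator A (\<omega> k) :: ennreal) \<in> borel_measurable (borel_pow N)"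
        by (rule measurable_compose[OF comp[OF k]]) simp
      have "emeasure (distr \<Sigma> borel (\<lambda>\<omega>. \<omega> k)) A = (\<integral>\<^sup>+p. indicator A p \<partial>distr \<Sigma> borel (\<lambda>\<omega>. \<omega> k))"
        by simp
      also have "\<dots> = (\<integral>\<^sup>+\<omega>. indicator A (\<omega> k) \<partial>\<Sigma>)"
        by (rule nn_integral_distr[OF comp_\<Sigma>]) measurable
      also have "\<dots> = (\<integral>\<^sup>+y. (\<integral>\<^sup>+\<omega>. indicator A (\<omega> k) \<partial>P (idx y)) \<partial>\<nu>)"
        unfolding \<Sigma>_def by (rule nn_integral_bind[OF ind measurable_prob_algebraD[OF kernel]])
      also have "\<dots> = (\<integral>\<^sup>+y. (\<integral>\<^sup>+p. indicator A p \<partial>\<kappa> k (idx y)) \<partial>\<nu>)"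
      proof (rule nn_integral_cong)
        fix y
        have "distr (P (idx y)) borel (\<lambda>\<omega>. \<omega> k) = distr (P (idx y)) (\<kappa> k (idx y)) (\<lambda>\<omega>. \<omega> k)"
          using k by (intro distr_cong) auto
        also have "\<dots> = \<kappa> k (idx y)"
          unfolding P_def using k by (intro distr_PiM_component \<kappa>_prob) auto
        finally have "(\<integral>\<^sup>+p. indicator A p \<partial>\<kappa> k (idx y)) = (\<integral>\<^sup>+p. indicator A p \<partial>distr (P (idx y)) borel (\<lambda>\<omega>. \<omega> k))"
          by simp
        also have "\<dots> = (\<integral>\<^sup>+\<omega>. indicator A (\<omega> k) \<partial>P (idx y))"
          by (rule nn_integral_distr[OF comp_P]) measurable
        finally show "(\<integral>\<^sup>+\<omega>. indicator A (\<omega> k) \<partial>P (idx y)) = (\<integral>\<^sup>+p. indicator A p \<partial>\<kappa> k (idx y))" by simp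
      qed
      also have "\<dots> = (\<integral>\<^sup>+p. indicator A p \<partial>\<pi> k)" by (rule \<kappa>_mean[OF k]) measurable
      also have "\<dots> = emeasure (\<pi> k) A" using \<pi>_sets[OF k] by simp
      finally show "emeasure (distr \<Sigma> borel (\<lambda>\<omega>. \<omega> k)) A = emeasure (\<pi> k) A" .
    qed (simp add: k)
  qed simp
  moreover have "AE \<omega> in \<Sigma>. \<forall>i<N. \<forall>j<N. dist (fst (\<omega> i)) (fst (\<omega> j)) < e"
  proof -
    let ?near = "\<lambda>\<omega> :: nat \<Rightarrow> 'a \<times> 'a. \<forall>i\<in>{..<N}. \<forall>j\<in>{..<N}. dist (fst (\<omega> i)) (fst (\<omega> j)) < e"
    have "AE y in \<nu>. \<forall>n. idx y = n \<longrightarrow> emeasure \<nu> {y. idx y = n} \<noteq> 0"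
    proof (subst AE_all_countable, intro allI)
      fix n
      show "AE y in \<nu>. idx y = n \<longrightarrow> emeasure \<nu> {y. idx y = n} \<noteq> 0"
      proof (cases "emeasure \<nu> {y. idx y = n} = 0")
        case True
        then have "AE y in \<nu>. y \<notin> {y. idx y = n}"
          by (intro AE_not_in) (auto simp: null_sets_def)
        then show ?thesis by eventually_elim auto
      qed simp
    qed
    then have "AE y in \<nu>. AE \<omega> in P (idx y). ?near \<omega>"
    proof eventually_elim
      fix y assume y: "\<forall>n. idx y = n \<longrightarrow> emeasure \<nu> {y. idx y = n} \<noteq> 0"
      define n where "n = idx y"
      have n: "emeasure \<nu> {y. idx y = n} \<noteq> 0" using y by (simp add: n_def)
      have "AE \<omega> in P n. idx (fst (\<omega> k)) = n" if k: "k < N" for k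
      proof -
        have "AE p in \<kappa> k n. idx (fst p) = n"
          unfolding \<kappa>_def using n k by (simp, intro AE_uniform_measureI) (auto simp: cell_def)
        then show ?thesis
          unfolding P_def using k by (intro AE_PiM_component \<kappa>_prob) auto
      qed
      then have "AE \<omega> in P n. \<forall>k\<in>{..<N}. idx (fst (\<omega> k)) = n"
        by (intro AE_finite_allI) auto
      then show "AE \<omega> in P (idx y). ?near \<omega>"
        unfolding n_def[symmetric]
      proof eventually_elim
        fix \<omega> :: "nat \<Rightarrow> 'a \<times> 'a" assume \<omega>: "\<forall>k\<in>{..<N}. idx (fst (\<omega> k)) = n"
        show "?near \<omega>"
        proof (intro ballI)
          fix i j assume "i \<in> {..<N}" "j \<in> {..<N}"
          then have "dist (q n) (fst (\<omega> i)) < e / 2" "dist (q n) (fst (\<omega> j)) < e / 2"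
            using \<omega> idx[of "fst (\<omega> i)"] idx[of "fst (\<omega> j)"] by auto
          then show "dist (fst (\<omega> i)) (fst (\<omega> j)) < e"
            using dist_triangle3[of "fst (\<omega> i)" "fst (\<omega> j)" "q n"] by linarith
        qed
      qed
    qed
    moreover have "Measurable.pred (borel_pow N) ?near"
    proof (intro pred_intros_finite)
      fix i j assume "i \<in> {..<N}" "j \<in> {..<N}"
      then have m: "(\<lambda>\<omega>. fst (\<omega> i) :: 'a) \<in> borel_measurable (borel_pow N)"
        "(\<lambda>\<omega>. fst (\<omega> j) :: 'a) \<in> borel_measurable (borel_pow N)"
        by (auto intro!: measurable_compose[OF comp borel_measurable_fst])
      show "Measurable.pred (borel_pow N) (\<lambda>\<omega>. dist (fst (\<omega> i) :: 'a) (fst (\<omega> j) :: 'a) < e)"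
        unfolding pred_def by (rule borel_measurable_less[OF borel_measurable_dist[OF m] borel_measurable_const])
    qed auto
    ultimately have "AE \<omega> in \<Sigma>. ?near \<omega>"
      unfolding \<Sigma>_def by (subst AE_bind[OF measurable_prob_algebraD[OF kernel]]) auto
    then show ?thesis by eventually_elim auto
  qed
  ultimately show ?thesis by (rule that)
qed

text \<open>
  The truncated distances between first components define a continuous cost on couplings of the
  \<open>\<pi> k\<close>.  Approximate gluing makes its infimum 0, and an optimal coupling attains it, so there the
  first components agree almost surely.
\<close>

lemma gluing:
  fixes \<pi> :: "nat \<Rightarrow> ('a::polish_space \<times> 'a) measure"
  assumes \<pi>: "\<And>k. k < N \<Longrightarrow> \<pi> k \<in> borel_probs" "\<And>k. k < N \<Longrightarrow> distr (\<pi> k) borel fst = \<nu>"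
    and \<nu>: "\<nu> \<in> borel_probs"
  obtains \<Sigma> where "\<Sigma> \<in> couplings N \<pi>" "AE \<omega> in \<Sigma>. \<forall>i<N. fst (\<omega> i) = fst (\<omega> 0)"
proof -
  define c where "c \<omega> = (\<Sum>i<N. min 1 (dist (fst (\<omega> i)) (fst (\<omega> 0))))" for \<omega> :: "nat \<Rightarrow> 'a \<times> 'a"
  have c_nonneg: "0 \<le> c \<omega>" for \<omega> by (auto simp: c_def intro: sum_nonneg)
  have lsc: "seq_lsc N c"
  proof (rule seq_lsc_of_tendsto)
    fix x and u :: "nat \<Rightarrow> nat \<Rightarrow> 'a \<times> 'a" assume u: "\<And>k. k < N \<Longrightarrow> (\<lambda>n. u n k) \<longlonglongrightarrow> x k"
    show "(\<lambda>n. c (u n)) \<longlonglongrightarrow> c x"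
      unfolding c_def by (rule tendsto_sum) (auto intro!: tendsto_intros u)
  qed
  obtain \<Sigma> where \<Sigma>: "\<Sigma> \<in> couplings N \<pi>"
    "\<And>\<gamma>'. \<gamma>' \<in> couplings N \<pi> \<Longrightarrow> (\<integral>\<^sup>+\<omega>. ennreal (c \<omega>) \<partial>\<Sigma>) \<le> (\<integral>\<^sup>+\<omega>. ennreal (c \<omega>) \<partial>\<gamma>')"
    by (rule optimal_coupling_exists[of N \<pi> c, OF \<pi>(1) lsc c_nonneg]) blast+
  have le: "(\<integral>\<^sup>+\<omega>. ennreal (c \<omega>) \<partial>\<Sigma>) \<le> 0 + ennreal e" if e: "0 < e" for e
  proof -
    define d where "d = e / (real N + 1)"
    have d: "0 < d" "real N * d \<le> e" using e by (auto simp: d_def field_simps)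
    obtain \<gamma>' where \<gamma>': "\<gamma>' \<in> couplings N \<pi>"
      "AE \<omega> in \<gamma>'. \<forall>i<N. \<forall>j<N. dist (fst (\<omega> i)) (fst (\<omega> j)) < d"
      by (rule approximate_gluing[of N \<pi> \<nu> d, OF \<pi> \<nu> d(1)])
    interpret \<gamma>': prob_space \<gamma>' by (rule couplingsD[OF \<gamma>'(1)])
    have "(\<integral>\<^sup>+\<omega>. ennreal (c \<omega>) \<partial>\<Sigma>) \<le> (\<integral>\<^sup>+\<omega>. ennreal (c \<omega>) \<partial>\<gamma>')" by (rule \<Sigma>) fact
    also have "\<dots> \<le> (\<integral>\<^sup>+\<omega>. ennreal e \<partial>\<gamma>')"
      using \<gamma>'(2)
    proof (intro nn_integral_mono_AE, eventually_elim)
      fix \<omega> :: "nat \<Rightarrow> 'a \<times> 'a" assume near: "\<forall>i<N. \<forall>j<N. dist (fst (\<omega> i)) (fst (\<omega> j)) < d"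
      have "c \<omega> \<le> (\<Sum>i<N. d)"
        unfolding c_def using near by (intro sum_mono min.coboundedI2) (auto intro!: less_imp_le)
      with d(2) show "ennreal (c \<omega>) \<le> ennreal e" by (intro ennreal_leI) simp
    qed
    finally show ?thesis by (simp add: \<gamma>'.emeasure_space_1)
  qed
  have "(\<integral>\<^sup>+\<omega>. ennreal (c \<omega>) \<partial>\<Sigma>) \<le> 0"
    by (rule ennreal_le_epsilon) (rule le)
  moreover have "(\<lambda>\<omega>. ennreal (c \<omega>)) \<in> borel_measurable \<Sigma>"
    using borel_measurable_seq_lsc[OF lsc c_nonneg] couplingsD(2)[OF \<Sigma>(1)] by (simp cong: measurable_cong_sets)
  ultimately have "AE \<omega> in \<Sigma>. ennreal (c \<omega>) = 0"
    by (simp add: nn_integral_0_iff_AE)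
  then have "AE \<omega> in \<Sigma>. \<forall>i<N. fst (\<omega> i) = fst (\<omega> 0)"
  proof eventually_elim
    fix \<omega> :: "nat \<Rightarrow> 'a \<times> 'a" assume "ennreal (c \<omega>) = 0"
    with c_nonneg[of \<omega>] have "c \<omega> = 0" by (simp add: ennreal_eq_0_iff)
    then have "\<forall>i\<in>{..<N}. min 1 (dist (fst (\<omega> i)) (fst (\<omega> 0))) = 0"
      unfolding c_def by (subst (asm) sum_nonneg_eq_0_iff) auto
    then show "\<forall>i<N. fst (\<omega> i) = fst (\<omega> 0)"
      by (auto simp: min_def split: if_splits)
  qed
  with \<Sigma>(1) show ?thesis by (rule that)
qed

section \<open>Functions in MI\<close>

lemma MI_D:
  assumes "\<phi> \<in> MI"
  shows MI_nonneg: "\<And>s. 0 \<le> s \<Longrightarrow> 0 \<le> \<phi> s"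
    and MI_mono: "\<And>s t. 0 \<le> s \<Longrightarrow> s \<le> t \<Longrightarrow> \<phi> s \<le> \<phi> t"
    and MI_less_iff: "\<And>s t. 0 \<le> s \<Longrightarrow> 0 \<le> t \<Longrightarrow> \<phi> s < \<phi> t \<longleftrightarrow> s < t"
    and MI_surj: "\<And>v. 0 \<le> v \<Longrightarrow> \<exists>s\<ge>0. \<phi> s = v"
    and MI_inverse: "\<And>v. 0 \<le> v \<Longrightarrow> \<phi> (phi_inv \<phi> v) = v"
    and MI_inverse': "\<And>s. 0 \<le> s \<Longrightarrow> phi_inv \<phi> (\<phi> s) = s"
    and MI_zero: "\<phi> 0 = 0"
proof -
  have bij: "bij_betw \<phi> {0..} {0..}" and sm: "strict_mono_on {0..} \<phi>"
    using assms by (auto simp: MI_def)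
  then have img: "\<phi> ` {0..} = {0..}" by (simp add: bij_betw_def)
  show nonneg: "0 \<le> \<phi> s" if "0 \<le> s" for s using img that by auto
  show mono: "\<phi> s \<le> \<phi> t" if "0 \<le> s" "s \<le> t" for s t
    using strict_mono_on_leD[OF sm] that by auto
  show "\<phi> s < \<phi> t \<longleftrightarrow> s < t" if "0 \<le> s" "0 \<le> t" for s t
    using strict_mono_on_less[OF sm] that by auto
  show surj: "\<exists>s\<ge>0. \<phi> s = v" if "0 \<le> v" for v
  proof -
    have "v \<in> \<phi> ` {0..}" using that by (simp add: img)
    then show ?thesis by auto
  qed
  show "\<phi> (phi_inv \<phi> v) = v" if "0 \<le> v" for v
    using that by (intro f_inv_into_f) (simp add: img)
  show "phi_inv \<phi> (\<phi> s) = s" if "0 \<le> s" for s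
    using that bij by (intro inv_into_f_f) (auto simp: bij_betw_def)
  obtain s where "0 \<le> s" "\<phi> s = 0" using surj[of 0] by auto
  with mono[of 0 s] nonneg[of 0] show "\<phi> 0 = 0" by simp
qed

text \<open>
  A monotone bijection of the half-line has no jumps.  It is extended by the identity to the negative
  numbers, because a monotone function with open image is continuous.
\<close>

lemma MI_continuous:
  assumes \<phi>: "\<phi> \<in> MI"
  shows "continuous_on {0..} \<phi>"
proof -
  define \<psi> where "\<psi> s = (if 0 \<le> s then \<phi> s else s)" for s
  have "\<exists>s. v = \<psi> s" for v
  proof (cases "0 \<le> v")
    case True
    then show ?thesis using MI_surj[OF \<phi> True] by (auto simp: \<psi>_def)
  qed (auto simp: \<psi>_def intro!: exI[of _ v])
  then have "range \<psi> = UNIV" unfolding surj_def by blast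
  then have "continuous_on UNIV \<psi>"
    using MI_mono[OF \<phi>] MI_nonneg[OF \<phi>]
    by (intro continuous_onI_mono) (auto simp: \<psi>_def intro: order_trans[of _ 0])
  then have "continuous_on {0..} \<psi>" by (rule continuous_on_subset) simp
  then show ?thesis by (rule continuous_on_eq) (simp add: \<psi>_def)
qed

lemma MI_tendsto:
  assumes "\<phi> \<in> MI" "(f \<longlongrightarrow> l) F" "\<And>x. 0 \<le> f x" "0 \<le> l"
  shows "((\<lambda>x. \<phi> (f x)) \<longlongrightarrow> \<phi> l) F"
  using assms by (intro continuous_on_tendsto_compose[OF MI_continuous[OF assms(1)]]) auto

lemma borel_measurable_MI_dist:
  fixes f g :: "'b \<Rightarrow> 'a::polish_space"
  assumes \<phi>: "\<phi> \<in> MI" and [measurable]: "f \<in> borel_measurable N" "g \<in> borel_measurable N"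
  shows "(\<lambda>x. \<phi> (dist (f x) (g x))) \<in> borel_measurable N"
proof -
  have "continuous_on UNIV (\<lambda>r. \<phi> (max 0 r))"
    by (rule continuous_on_compose2[OF MI_continuous[OF \<phi>]]) (auto intro!: continuous_intros)
  then have [measurable]: "(\<lambda>r. \<phi> (max 0 r)) \<in> borel_measurable borel"
    by (rule borel_measurable_continuous_onI)
  have "(\<lambda>x. (\<lambda>r. \<phi> (max 0 r)) (dist (f x) (g x))) \<in> borel_measurable N"
    by measurable
  then show ?thesis by simp
qed

text \<open>
  Along the diagonal, concavity of
  \<open>\<phi> (phi_inv \<phi> x0 + phi_inv \<phi> x1)\<close> together with the value 0 at the origin bounds \<open>\<phi> (2 * s)\<close> by a
  multiple of \<open>\<phi> s\<close> once \<open>s \<ge> 1\<close>; for smaller \<open>s\<close> monotonicity suffices, at the price of the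
  summand 1.
\<close>

lemma MI_growth:
  assumes \<phi>: "\<phi> \<in> MI"
  obtains C where "0 \<le> C" "\<And>s t. 0 \<le> s \<Longrightarrow> 0 \<le> t \<Longrightarrow> \<phi> (s + t) \<le> C * (1 + \<phi> s + \<phi> t)"
proof -
  note nonneg = MI_nonneg[OF \<phi>] and mono = MI_mono[OF \<phi>]
  have \<phi>1: "0 < \<phi> 1" using MI_less_iff[OF \<phi>, of 0 1] MI_zero[OF \<phi>] by simp
  have conc: "concave_on ({0..} \<times> {0..}) (\<lambda>(x0, x1). \<phi> (phi_inv \<phi> x0 + phi_inv \<phi> x1))"
    using \<phi> by (simp add: MI_def)
  have double: "\<phi> (2 * s) \<le> \<phi> 2 / \<phi> 1 * \<phi> s" if s: "1 \<le> s" for s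
  proof -
    define t where "t = \<phi> 1 / \<phi> s"
    have \<phi>s: "\<phi> 1 \<le> \<phi> s" using mono[of 1 s] s by simp
    with \<phi>1 have t: "0 \<le> t" "t \<le> 1" "t * \<phi> s = \<phi> 1" by (auto simp: t_def)
    have "\<phi> (phi_inv \<phi> (t * \<phi> s) + phi_inv \<phi> (t * \<phi> s))
        \<ge> (1 - t) * \<phi> (phi_inv \<phi> 0 + phi_inv \<phi> 0) + t * \<phi> (phi_inv \<phi> (\<phi> s) + phi_inv \<phi> (\<phi> s))"
      using concave_onD[OF conc t(1,2), of "(0, 0)" "(\<phi> s, \<phi> s)"] nonneg[of s] s by simp
    moreover have "phi_inv \<phi> 0 = 0"
      using MI_inverse'[OF \<phi> order_refl] unfolding MI_zero[OF \<phi>] .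
    moreover have "phi_inv \<phi> (\<phi> 1) = 1" "phi_inv \<phi> (\<phi> s) = s"
      by (rule MI_inverse'[OF \<phi>], use s in linarith)+
    ultimately have "(1 - t) * \<phi> (0 + 0) + t * \<phi> (s + s) \<le> \<phi> (1 + 1)"
      unfolding t(3) by (simp only:)
    then have "t * \<phi> (2 * s) \<le> \<phi> 2"
      using MI_zero[OF \<phi>] by (simp flip: mult_2)
    then have "\<phi> 1 * \<phi> (2 * s) \<le> \<phi> 2 * \<phi> s"
      using \<phi>1 \<phi>s by (simp add: t_def divide_le_eq)
    then show ?thesis using \<phi>1 by (simp add: le_divide_eq mult.commute)
  qed
  define C where "C = max (\<phi> 2) (\<phi> 2 / \<phi> 1)"
  have C: "\<phi> 2 \<le> C" "\<phi> 2 / \<phi> 1 \<le> C" "0 \<le> C" using nonneg[of 2] by (auto simp: C_def le_max_iff_disj)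
  have double': "\<phi> (2 * s) \<le> C * (1 + \<phi> s)" if s: "0 \<le> s" for s
  proof (cases "1 \<le> s")
    case True
    have "\<phi> (2 * s) \<le> C * \<phi> s"
      using double[OF True] mult_right_mono[OF C(2) nonneg[OF s]] by linarith
    also have "\<dots> \<le> C * (1 + \<phi> s)" using C(3) by (simp add: algebra_simps)
    finally show ?thesis .
  next
    case False
    then have "\<phi> (2 * s) \<le> C" using mono[of "2 * s" 2] s C(1) by simp
    also have "\<dots> \<le> C * (1 + \<phi> s)" using C(3) nonneg[OF s] by (simp add: algebra_simps)
    finally show ?thesis .
  qed
  show ?thesis
  proof (rule that[of C, OF C(3)])
    fix s t :: real assume s: "0 \<le> s" and t: "0 \<le> t"
    have "\<phi> (s + t) \<le> \<phi> (2 * max s t)" using s t by (intro mono) auto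
    also have "\<dots> \<le> C * (1 + \<phi> (max s t))" using s by (intro double') simp
    also have "\<dots> \<le> C * (1 + \<phi> s + \<phi> t)"
      using C(3) nonneg[OF s] nonneg[OF t] by (intro mult_left_mono) (auto simp: max_def)
    finally show "\<phi> (s + t) \<le> C * (1 + \<phi> s + \<phi> t)" .
  qed
qed

lemma nn_integral_MI_triangle:
  fixes f g h :: "'b \<Rightarrow> 'a::polish_space"
  assumes \<phi>: "\<phi> \<in> MI" and N: "prob_space N"
    and [measurable]: "f \<in> borel_measurable N" "g \<in> borel_measurable N" "h \<in> borel_measurable N"
    and fg: "(\<integral>\<^sup>+x. ennreal (\<phi> (dist (f x) (g x))) \<partial>N) < \<infinity>"
    and gh: "(\<integral>\<^sup>+x. ennreal (\<phi> (dist (g x) (h x))) \<partial>N) < \<infinity>"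
  shows "(\<integral>\<^sup>+x. ennreal (\<phi> (dist (f x) (h x))) \<partial>N) < \<infinity>"
proof -
  interpret prob_space N by fact
  obtain C where C: "0 \<le> C" "\<And>s t. 0 \<le> s \<Longrightarrow> 0 \<le> t \<Longrightarrow> \<phi> (s + t) \<le> C * (1 + \<phi> s + \<phi> t)"
    by (rule MI_growth[OF \<phi>]) blast
  note nonneg = MI_nonneg[OF \<phi>]
  have [measurable]: "(\<lambda>x. \<phi> (dist (f x) (g x))) \<in> borel_measurable N" "(\<lambda>x. \<phi> (dist (g x) (h x))) \<in> borel_measurable N"
    by (auto intro!: borel_measurable_MI_dist \<phi>)
  have "(\<integral>\<^sup>+x. ennreal (\<phi> (dist (f x) (h x))) \<partial>N)
      \<le> (\<integral>\<^sup>+x. ennreal C * (1 + (ennreal (\<phi> (dist (f x) (g x))) + ennreal (\<phi> (dist (g x) (h x))))) \<partial>N)"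
  proof (rule nn_integral_mono)
    fix x
    have "\<phi> (dist (f x) (h x)) \<le> \<phi> (dist (f x) (g x) + dist (g x) (h x))"
      by (intro MI_mono[OF \<phi>] dist_triangle) simp
    also have "\<dots> \<le> C * (1 + \<phi> (dist (f x) (g x)) + \<phi> (dist (g x) (h x)))"
      by (rule C) auto
    finally have "ennreal (\<phi> (dist (f x) (h x))) \<le> ennreal (C * (1 + (\<phi> (dist (f x) (g x)) + \<phi> (dist (g x) (h x)))))"
      by (simp add: add.assoc ennreal_leI)
    also have "\<dots> = ennreal C * (1 + (ennreal (\<phi> (dist (f x) (g x))) + ennreal (\<phi> (dist (g x) (h x)))))"
      using C(1) nonneg by (simp add: ennreal_mult)
    finally show "ennreal (\<phi> (dist (f x) (h x))) \<le> ennreal C * (1 + (ennreal (\<phi> (dist (f x) (g x))) + ennreal (\<phi> (dist (g x) (h x)))))" .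
  qed
  also have "\<dots> = ennreal C * (1 + ((\<integral>\<^sup>+x. ennreal (\<phi> (dist (f x) (g x))) \<partial>N) + (\<integral>\<^sup>+x. ennreal (\<phi> (dist (g x) (h x))) \<partial>N)))"
    by (simp add: nn_integral_cmult nn_integral_add emeasure_space_1)
  also have "\<dots> < \<infinity>"
    using fg gh by (simp add: ennreal_mult_less_top)
  finally show ?thesis .
qed

section \<open>Star couplings and the barycenter functional\<close>

text \<open>
  By the growth bound, moving the base point changes the moment at most by a factor and a summand
  that depends on the distance moved.
\<close>

lemma P_phi_iff:
  assumes \<phi>: "\<phi> \<in> MI"
  shows "\<mu> \<in> P_phi \<phi> \<longleftrightarrow> \<mu> \<in> borel_probs \<and> (\<forall>y. (\<integral>\<^sup>+x. ennreal (\<phi> (dist x y)) \<partial>\<mu>) < \<infinity>)"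
proof
  assume "\<mu> \<in> P_phi \<phi>"
  then obtain y where \<mu>: "\<mu> \<in> borel_probs" and y: "(\<integral>\<^sup>+x. ennreal (\<phi> (dist x y)) \<partial>\<mu>) < \<infinity>"
    by (auto simp: P_phi_def)
  have [measurable_cong]: "sets \<mu> = sets borel" and p: "prob_space \<mu>" using \<mu> by (auto simp: borel_probs_def)
  interpret prob_space \<mu> by fact
  have "(\<integral>\<^sup>+x. ennreal (\<phi> (dist x z)) \<partial>\<mu>) < \<infinity>" for z
    by (rule nn_integral_MI_triangle[OF \<phi> p, where g = "\<lambda>_. y"]) (use y in \<open>auto simp: emeasure_space_1\<close>)
  with \<mu> show "\<mu> \<in> borel_probs \<and> (\<forall>y. (\<integral>\<^sup>+x. ennreal (\<phi> (dist x y)) \<partial>\<mu>) < \<infinity>)" by blast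
qed (auto simp: P_phi_def)

lemma pair_marginal_couplings2:
  assumes \<gamma>: "\<gamma> \<in> couplings K \<mu>" and "i < K" "j < K"
  shows "distr \<gamma> borel (\<lambda>x. (x i, x j)) \<in> couplings2 (\<mu> i) (\<mu> j)"
    "f \<in> borel_measurable borel \<Longrightarrow>
      (\<integral>\<^sup>+p. f p \<partial>distr \<gamma> borel (\<lambda>x. (x i, x j))) = (\<integral>\<^sup>+x. f (x i, x j) \<partial>\<gamma>)"
proof -
  interpret prob_space \<gamma> by (rule couplingsD[OF \<gamma>])
  note [measurable] = couplingsD(5)[OF \<gamma> \<open>i < K\<close>] couplingsD(5)[OF \<gamma> \<open>j < K\<close>]
  have pair [measurable]: "(\<lambda>x. (x i, x j)) \<in> measurable \<gamma> borel"
    unfolding borel_prod[symmetric] by measurable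
  show "distr \<gamma> borel (\<lambda>x. (x i, x j)) \<in> couplings2 (\<mu> i) (\<mu> j)"
    unfolding couplings2_def borel_probs_def
    using couplingsD(4)[OF \<gamma>] \<open>i < K\<close> \<open>j < K\<close>
    by (simp add: prob_space_distr distr_distr comp_def)
  show "(\<integral>\<^sup>+p. f p \<partial>distr \<gamma> borel (\<lambda>x. (x i, x j))) = (\<integral>\<^sup>+x. f (x i, x j) \<partial>\<gamma>)"
    if "f \<in> borel_measurable borel"
    by (rule nn_integral_distr[OF pair]) (use that in simp)
qed

definition transport_cost ::
  "(real \<Rightarrow> real) \<Rightarrow> 'a::polish_space measure \<Rightarrow> 'a measure \<Rightarrow> ennreal" where
  "transport_cost \<phi> \<mu> \<nu> = (INF \<gamma>\<in>couplings2 \<mu> \<nu>. \<integral>\<^sup>+ (x, y). ennreal (\<phi> (dist x y)) \<partial>\<gamma>)"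

lemma phi_W_phi: "\<phi> \<in> MI \<Longrightarrow> \<phi> (W_phi \<phi> \<mu> \<nu>) = enn2real (transport_cost \<phi> \<mu> \<nu>)"
  unfolding W_phi_def transport_cost_def by (rule MI_inverse) simp_all

lemma transport_cost_finite:
  assumes \<phi>: "\<phi> \<in> MI" and \<mu>: "\<mu> \<in> P_phi \<phi>" and \<nu>: "\<nu> \<in> P_phi \<phi>"
  shows "transport_cost \<phi> \<mu> \<nu> < \<infinity>"
proof -
  define m where "m i = (if i = 0 then \<mu> else \<nu>)" for i :: nat
  have m: "m i \<in> borel_probs" for i using \<mu> \<nu> by (auto simp: m_def P_phi_def)
  define \<gamma> where "\<gamma> = Pi\<^sub>M {..<2} m"
  have \<gamma>: "\<gamma> \<in> couplings 2 m" unfolding \<gamma>_def by (rule product_coupling[OF m])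
  note [measurable] = couplingsD(5)[OF \<gamma>, of 0, simplified] couplingsD(5)[OF \<gamma>, of 1, simplified]
  interpret prob_space \<gamma> by (rule couplingsD[OF \<gamma>])
  define z :: 'a where "z = undefined"
  have c: "(\<lambda>y. \<phi> (dist y z)) \<in> borel_measurable borel" by (intro borel_measurable_MI_dist \<phi>) auto
  have c2: "(\<lambda>p. \<phi> (dist (fst p :: 'a) (snd p))) \<in> borel_measurable borel"
    by (intro borel_measurable_MI_dist \<phi>) measurable
  have fin: "(\<integral>\<^sup>+x. ennreal (\<phi> (dist (x k) z)) \<partial>\<gamma>) < \<infinity>" if "k < 2" for k
    using \<mu> \<nu> c by (subst nn_integral_coupling_component[OF \<gamma> that]) (auto simp: m_def P_phi_iff[OF \<phi>])
  have "transport_cost \<phi> \<mu> \<nu> \<le> (\<integral>\<^sup>+ (x, y). ennreal (\<phi> (dist x y)) \<partial>distr \<gamma> borel (\<lambda>x. (x 0, x 1)))"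
    unfolding transport_cost_def
    using pair_marginal_couplings2(1)[OF \<gamma>, of 0 1] by (intro INF_lower) (simp add: m_def)
  also have "\<dots> = (\<integral>\<^sup>+x. ennreal (\<phi> (dist (x 0) (x 1))) \<partial>\<gamma>)"
    using c2 by (subst pair_marginal_couplings2(2)[OF \<gamma>]) (auto simp: case_prod_beta')
  also have "\<dots> < \<infinity>"
    by (rule nn_integral_MI_triangle[OF \<phi> prob_space_axioms, where g = "\<lambda>_. z"])
      (use fin[of 0] fin[of 1] in \<open>auto simp: dist_commute\<close>)
  finally show ?thesis .
qed

lemma nn_integral_weighted_sum:
  assumes f: "\<And>k. k < K \<Longrightarrow> f k \<in> borel_measurable M"
  shows "(\<integral>\<^sup>+x. (\<Sum>k<K. ennreal (\<tau> k) * ennreal (f k x)) \<partial>M) = (\<Sum>k<K. ennreal (\<tau> k) * (\<integral>\<^sup>+x. ennreal (f k x) \<partial>M))"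
proof -
  have m: "(\<lambda>x. ennreal (f k x)) \<in> borel_measurable M" if "k \<in> {..<K}" for k
    using f[of k] that by auto
  have "(\<integral>\<^sup>+x. (\<Sum>k<K. ennreal (\<tau> k) * ennreal (f k x)) \<partial>M) = (\<Sum>k<K. \<integral>\<^sup>+x. ennreal (\<tau> k) * ennreal (f k x) \<partial>M)"
    using m by (intro nn_integral_sum) auto
  also have "\<dots> = (\<Sum>k<K. ennreal (\<tau> k) * (\<integral>\<^sup>+x. ennreal (f k x) \<partial>M))"
    using m by (intro sum.cong nn_integral_cmult) auto
  finally show ?thesis .
qed

lemma point_cost_nonneg:
  assumes "\<phi> \<in> MI" "\<tau> \<in> weights K"
  shows "0 \<le> point_cost \<phi> K \<tau> x z"
  using assms unfolding point_cost_def weights_def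
  by (intro sum_nonneg mult_nonneg_nonneg MI_nonneg[OF assms(1)]) auto

lemma ennreal_point_cost:
  assumes "\<phi> \<in> MI" "\<tau> \<in> weights K"
  shows "ennreal (point_cost \<phi> K \<tau> x z) = (\<Sum>k<K. ennreal (\<tau> k) * ennreal (\<phi> (dist z (x k))))"
  using assms unfolding point_cost_def weights_def
  by (subst sum_ennreal[symmetric]) (auto simp: ennreal_mult MI_nonneg[OF assms(1)])

text \<open>
  A star coupling is a coupling of \<open>\<mu> 0, \<dots>, \<mu> (K - 1)\<close> with a further measure \<open>\<nu>\<close> placed at index \<open>K\<close>,
  the center of the star.  Its cost is the point cost at the center.  Its marginals on the pairs
  \<open>(K, k)\<close> are competitors in the transport problems between \<open>\<nu>\<close> and \<open>\<mu> k\<close>, so the barycenter functional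
  of \<open>\<nu>\<close> is at most the star cost.
\<close>

lemma barycenter_functional_le_star_cost:
  fixes \<mu> :: "nat \<Rightarrow> 'a::polish_space measure"
  assumes \<phi>: "\<phi> \<in> MI" and \<tau>: "\<tau> \<in> weights K" and \<sigma>: "\<sigma> \<in> couplings (Suc K) (\<mu>(K := \<nu>))"
  shows "ennreal (\<Sum>k<K. \<tau> k * \<phi> (W_phi \<phi> \<nu> (\<mu> k))) \<le> (\<integral>\<^sup>+x. ennreal (point_cost \<phi> K \<tau> x (x K)) \<partial>\<sigma>)"
proof -
  have \<tau>0: "0 \<le> \<tau> k" if "k < K" for k using \<tau> that by (auto simp: weights_def)
  have c2: "(\<lambda>p. \<phi> (dist (fst p :: 'a) (snd p))) \<in> borel_measurable borel"
    by (intro borel_measurable_MI_dist \<phi>) measurable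
  have meas: "(\<lambda>x. \<phi> (dist (x K) (x k))) \<in> borel_measurable \<sigma>" if "k < K" for k
    using that by (intro borel_measurable_MI_dist \<phi> couplingsD(5)[OF \<sigma>]) auto
  have "ennreal (\<phi> (W_phi \<phi> \<nu> (\<mu> k))) \<le> (\<integral>\<^sup>+x. ennreal (\<phi> (dist (x K) (x k))) \<partial>\<sigma>)" if k: "k < K" for k
  proof -
    have "ennreal (\<phi> (W_phi \<phi> \<nu> (\<mu> k))) \<le> transport_cost \<phi> \<nu> (\<mu> k)"
      unfolding phi_W_phi[OF \<phi>] by (cases "transport_cost \<phi> \<nu> (\<mu> k)") auto
    also have "\<dots> \<le> (\<integral>\<^sup>+ (x, y). ennreal (\<phi> (dist x y)) \<partial>distr \<sigma> borel (\<lambda>x. (x K, x k)))"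
      unfolding transport_cost_def
      using pair_marginal_couplings2(1)[OF \<sigma>, of K k] k by (intro INF_lower) simp
    also have "\<dots> = (\<integral>\<^sup>+x. ennreal (\<phi> (dist (x K) (x k))) \<partial>\<sigma>)"
      using c2 k by (subst pair_marginal_couplings2(2)[OF \<sigma>]) (auto simp: case_prod_beta')
    finally show ?thesis .
  qed
  then have "(\<Sum>k<K. ennreal (\<tau> k) * ennreal (\<phi> (W_phi \<phi> \<nu> (\<mu> k))))
      \<le> (\<Sum>k<K. ennreal (\<tau> k) * (\<integral>\<^sup>+x. ennreal (\<phi> (dist (x K) (x k))) \<partial>\<sigma>))"
    by (intro sum_mono mult_left_mono) auto
  also have "\<dots> = (\<integral>\<^sup>+x. ennreal (point_cost \<phi> K \<tau> x (x K)) \<partial>\<sigma>)"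
    unfolding ennreal_point_cost[OF \<phi> \<tau>] using meas by (intro nn_integral_weighted_sum[symmetric])
  finally show ?thesis
    using \<tau>0 by (subst sum_ennreal[symmetric]) (auto simp: ennreal_mult phi_W_phi[OF \<phi>])
qed

lemma seq_lsc_star_cost:
  assumes \<phi>: "\<phi> \<in> MI"
  shows "seq_lsc (Suc K) (\<lambda>x :: nat \<Rightarrow> 'a::polish_space. point_cost \<phi> K \<tau> x (x K))"
proof (rule seq_lsc_of_tendsto)
  fix x and u :: "nat \<Rightarrow> nat \<Rightarrow> 'a" assume u: "\<And>k. k < Suc K \<Longrightarrow> (\<lambda>n. u n k) \<longlonglongrightarrow> x k"
  show "(\<lambda>n. point_cost \<phi> K \<tau> (u n) (u n K)) \<longlonglongrightarrow> point_cost \<phi> K \<tau> x (x K)"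
    unfolding point_cost_def
    by (intro tendsto_sum tendsto_mult tendsto_const MI_tendsto[OF \<phi>] tendsto_dist u) auto
qed

text \<open>
  Conversely, the barycenter functional of \<open>\<nu>\<close> is attained as a star cost.  Nearly optimal transport
  plans between \<open>\<nu>\<close> and the \<open>\<mu> k\<close> can be glued along \<open>\<nu>\<close> to a star coupling with nearly the right cost,
  and a star coupling of minimal cost removes the error.
\<close>

lemma star_coupling_exists:
  fixes \<mu> :: "nat \<Rightarrow> 'a::polish_space measure"
  assumes \<phi>: "\<phi> \<in> MI" and \<tau>: "\<tau> \<in> weights K"
    and \<mu>: "\<And>k. k < K \<Longrightarrow> \<mu> k \<in> P_phi \<phi>" and \<nu>: "\<nu> \<in> P_phi \<phi>"
  obtains \<sigma> where "\<sigma> \<in> couplings (Suc K) (\<mu>(K := \<nu>))"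
    "(\<integral>\<^sup>+x. ennreal (point_cost \<phi> K \<tau> x (x K)) \<partial>\<sigma>) \<le> ennreal (\<Sum>k<K. \<tau> k * \<phi> (W_phi \<phi> \<nu> (\<mu> k)))"
proof -
  let ?B = "\<Sum>k<K. \<tau> k * \<phi> (W_phi \<phi> \<nu> (\<mu> k))"
  let ?cost = "\<lambda>\<sigma>. \<integral>\<^sup>+x. ennreal (point_cost \<phi> K \<tau> x (x K)) \<partial>\<sigma>"
  have \<tau>0: "0 \<le> \<tau> k" if "k < K" for k using \<tau> that by (auto simp: weights_def)
  have "0 < K" using \<tau> by (cases K) (auto simp: weights_def)
  have probs: "(\<mu>(K := \<nu>)) k \<in> borel_probs" if "k < Suc K" for k
    using \<mu>[of k] \<nu> that by (auto simp: P_phi_def less_Suc_eq)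
  have W: "transport_cost \<phi> \<nu> (\<mu> k) = ennreal (\<phi> (W_phi \<phi> \<nu> (\<mu> k)))" if "k < K" for k
    using transport_cost_finite[OF \<phi> \<nu> \<mu>[OF that]] by (simp add: phi_W_phi[OF \<phi>])
  have W0: "0 \<le> \<phi> (W_phi \<phi> \<nu> (\<mu> k))" for k by (simp add: phi_W_phi[OF \<phi>])
  obtain \<sigma> where \<sigma>: "\<sigma> \<in> couplings (Suc K) (\<mu>(K := \<nu>))"
    "\<And>\<sigma>'. \<sigma>' \<in> couplings (Suc K) (\<mu>(K := \<nu>)) \<Longrightarrow> ?cost \<sigma> \<le> ?cost \<sigma>'"
    by (rule optimal_coupling_exists[OF probs seq_lsc_star_cost[OF \<phi>] point_cost_nonneg[OF \<phi> \<tau>]]) blast+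
  have le: "?cost \<sigma> \<le> ennreal ?B + ennreal e" if e: "0 < e" for e
  proof -
    have "\<exists>p. p \<in> couplings2 \<nu> (\<mu> k) \<and>
        (\<integral>\<^sup>+ (x, y). ennreal (\<phi> (dist x y)) \<partial>p) < ennreal (\<phi> (W_phi \<phi> \<nu> (\<mu> k)) + e)" if k: "k < K" for k
    proof -
      have "transport_cost \<phi> \<nu> (\<mu> k) < ennreal (\<phi> (W_phi \<phi> \<nu> (\<mu> k)) + e)"
        unfolding W[OF k] using e W0 by (simp add: ennreal_less_iff)
      then show ?thesis unfolding transport_cost_def INF_less_iff by blast
    qed
    then obtain p where p: "\<And>k. k < K \<Longrightarrow> p k \<in> couplings2 \<nu> (\<mu> k)"
      "\<And>k. k < K \<Longrightarrow> (\<integral>\<^sup>+ (x, y). ennreal (\<phi> (dist x y)) \<partial>p k) < ennreal (\<phi> (W_phi \<phi> \<nu> (\<mu> k)) + e)"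
      by metis
    obtain \<Sigma> where \<Sigma>: "\<Sigma> \<in> couplings K p" "AE \<omega> in \<Sigma>. \<forall>i<K. fst (\<omega> i) = fst (\<omega> 0)"
      using gluing[of K p \<nu>] p(1) \<nu> by (auto simp: couplings2_def P_phi_def)
    interpret \<Sigma>: prob_space \<Sigma> by (rule couplingsD[OF \<Sigma>(1)])
    \<comment> \<open>The glued first component becomes the center; index 0 exists because weights force \<open>0 < K\<close>.\<close>
    define h where "h \<omega> = (\<lambda>i\<in>{..<Suc K}. if i < K then snd (\<omega> i) else fst (\<omega> 0))" for \<omega> :: "nat \<Rightarrow> 'a \<times> 'a"
    have comp [measurable]: "(\<lambda>\<omega>. \<omega> k) \<in> measurable \<Sigma> borel" if "k < K" for k
      by (rule couplingsD(5)[OF \<Sigma>(1) that])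
    have h_meas [measurable]: "h \<in> measurable \<Sigma> (borel_pow (Suc K))"
      unfolding h_def[abs_def]
    proof (rule measurable_restrict)
      fix i assume "i \<in> {..<Suc K}"
      show "(\<lambda>\<omega>. if i < K then snd (\<omega> i) else fst (\<omega> 0)) \<in> measurable \<Sigma> borel"
        using measurable_compose[OF comp borel_measurable_snd, of i]
          measurable_compose[OF comp[OF \<open>0 < K\<close>] borel_measurable_fst] by (cases "i < K") auto
    qed
    define \<sigma>' where "\<sigma>' = distr \<Sigma> (borel_pow (Suc K)) h"
    have marg: "distr \<Sigma> borel (\<lambda>\<omega>. f (\<omega> k)) = distr (p k) borel f"
      if "k < K" "f \<in> measurable borel borel" for f :: "'a \<times> 'a \<Rightarrow> 'a" and k
      using couplingsD(4)[OF \<Sigma>(1) that(1)] distr_distr[OF that(2) comp[OF that(1)]] by (simp add: comp_def)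
    have \<sigma>'_coupling: "\<sigma>' \<in> couplings (Suc K) (\<mu>(K := \<nu>))"
    proof (rule couplingsI)
      show "prob_space \<sigma>'" unfolding \<sigma>'_def by (rule \<Sigma>.prob_space_distr) measurable
      fix k assume k: "k < Suc K"
      have "distr \<sigma>' borel (\<lambda>x. x k) = distr \<Sigma> borel (\<lambda>\<omega>. h \<omega> k)"
        unfolding \<sigma>'_def using k by (subst distr_distr) (auto simp: comp_def)
      also have "\<dots> = (\<mu>(K := \<nu>)) k"
      proof (cases "k < K")
        case True
        then show ?thesis
          using marg[OF True borel_measurable_snd] p(1)[OF True] by (simp add: h_def couplings2_def)
      next
        case False
        with k have "k = K" by simp
        then show ?thesis
          using marg[OF \<open>0 < K\<close> borel_measurable_fst] p(1)[OF \<open>0 < K\<close>] by (simp add: h_def couplings2_def)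
      qed
      finally show "distr \<sigma>' borel (\<lambda>x. x k) = (\<mu>(K := \<nu>)) k" .
    qed (simp add: \<sigma>'_def)
    have c2: "(\<lambda>p. \<phi> (dist (fst p :: 'a) (snd p))) \<in> borel_measurable borel"
      by (intro borel_measurable_MI_dist \<phi>) measurable
    have "?cost \<sigma> \<le> ?cost \<sigma>'" by (rule \<sigma>) fact
    also have "\<dots> = (\<integral>\<^sup>+\<omega>. ennreal (point_cost \<phi> K \<tau> (h \<omega>) (h \<omega> K)) \<partial>\<Sigma>)"
      unfolding \<sigma>'_def
      by (rule nn_integral_distr[OF h_meas])
        (subst measurable_distr_eq1, rule borel_measurable_seq_lsc[OF seq_lsc_star_cost[OF \<phi>] point_cost_nonneg[OF \<phi> \<tau>]])
    also have "\<dots> = (\<integral>\<^sup>+\<omega>. (\<Sum>k<K. ennreal (\<tau> k) * ennreal (\<phi> (dist (fst (\<omega> k)) (snd (\<omega> k))))) \<partial>\<Sigma>)"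
      using \<Sigma>(2)
    proof (intro nn_integral_cong_AE, eventually_elim)
      fix \<omega> :: "nat \<Rightarrow> 'a \<times> 'a" assume eq: "\<forall>i<K. fst (\<omega> i) = fst (\<omega> 0)"
      show "ennreal (point_cost \<phi> K \<tau> (h \<omega>) (h \<omega> K))
          = (\<Sum>k<K. ennreal (\<tau> k) * ennreal (\<phi> (dist (fst (\<omega> k)) (snd (\<omega> k)))))"
        unfolding ennreal_point_cost[OF \<phi> \<tau>]
      proof (intro sum.cong refl)
        fix k assume k: "k \<in> {..<K}"
        with eq have "fst (\<omega> k) = fst (\<omega> 0)" by blast
        with k show "ennreal (\<tau> k) * ennreal (\<phi> (dist (h \<omega> K) (h \<omega> k)))
            = ennreal (\<tau> k) * ennreal (\<phi> (dist (fst (\<omega> k)) (snd (\<omega> k))))"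
          by (simp add: h_def)
      qed
    qed
    also have "\<dots> = (\<Sum>k<K. ennreal (\<tau> k) * (\<integral>\<^sup>+\<omega>. ennreal (\<phi> (dist (fst (\<omega> k)) (snd (\<omega> k)))) \<partial>\<Sigma>))"
    proof -
      have "(\<lambda>\<omega>. \<phi> (dist (fst (\<omega> k)) (snd (\<omega> k)))) \<in> borel_measurable \<Sigma>" if "k < K" for k
        using measurable_compose[OF comp[OF that] c2] .
      then show ?thesis by (intro nn_integral_weighted_sum)
    qed
    also have "\<dots> \<le> (\<Sum>k<K. ennreal (\<tau> k) * ennreal (\<phi> (W_phi \<phi> \<nu> (\<mu> k)) + e))"
    proof (intro sum_mono mult_left_mono)
      fix k assume "k \<in> {..<K}"
      then have k: "k < K" by simp
      show "(\<integral>\<^sup>+\<omega>. ennreal (\<phi> (dist (fst (\<omega> k)) (snd (\<omega> k)))) \<partial>\<Sigma>) \<le> ennreal (\<phi> (W_phi \<phi> \<nu> (\<mu> k)) + e)"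
        using p(2)[OF k] c2
        by (subst nn_integral_coupling_component[OF \<Sigma>(1) k, where f = "\<lambda>p. ennreal (\<phi> (dist (fst p) (snd p)))"])
          (auto simp: case_prod_beta' intro: less_imp_le)
    qed simp
    also have "\<dots> = ennreal (\<Sum>k<K. \<tau> k * (\<phi> (W_phi \<phi> \<nu> (\<mu> k)) + e))"
      using \<tau>0 W0 e by (subst sum_ennreal[symmetric]) (auto simp: ennreal_mult)
    also have "(\<Sum>k<K. \<tau> k * (\<phi> (W_phi \<phi> \<nu> (\<mu> k)) + e)) = ?B + e"
      using \<tau> by (simp add: weights_def distrib_left sum.distrib sum_distrib_right[symmetric])
    also have "ennreal (?B + e) = ennreal ?B + ennreal e"
      using \<tau>0 W0 e by (intro ennreal_plus sum_nonneg) auto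
    finally show ?thesis .
  qed
  have "?cost \<sigma> \<le> ennreal ?B" by (rule ennreal_le_epsilon) (rule le)
  with \<sigma>(1) show ?thesis by (rule that)
qed

section \<open>The infimum cost and barycenter maps\<close>

lemma point_cost_cong: "(\<And>k. k < K \<Longrightarrow> x k = y k) \<Longrightarrow> point_cost \<phi> K \<tau> x z = point_cost \<phi> K \<tau> y z"
  by (simp add: point_cost_def)

lemma INF_point_cost_le:
  assumes "\<phi> \<in> MI" "\<tau> \<in> weights K"
  shows "(INF z. point_cost \<phi> K \<tau> x z) \<le> point_cost \<phi> K \<tau> x z"
  using point_cost_nonneg[OF assms] by (intro cINF_lower bdd_belowI2[where m = 0]) auto

lemma INF_point_cost_nonneg:
  assumes "\<phi> \<in> MI" "\<tau> \<in> weights K"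
  shows "0 \<le> (INF z. point_cost \<phi> K \<tau> x z)"
  using point_cost_nonneg[OF assms] by (intro cINF_greatest) auto

text \<open>
  Moving the point \<open>y\<close> slightly changes the weighted cost of reaching it little, uniformly over all
  \<open>z\<close> whose cost is bounded by \<open>C\<close>: these \<open>z\<close> stay at bounded distance, and \<open>\<phi>\<close> is uniformly continuous
  on bounded intervals.  A factor \<open>t = 0\<close> imposes no bound on \<open>z\<close>, but then both sides vanish.
\<close>

lemma MI_weighted_dist_uniform:
  fixes y :: "'a::polish_space" and w :: "nat \<Rightarrow> 'a"
  assumes \<phi>: "\<phi> \<in> MI" and t: "0 \<le> t" and e: "0 < e" and w: "w \<longlonglongrightarrow> y"
  shows "\<forall>\<^sub>F n in sequentially. \<forall>z. t * \<phi> (dist z (w n)) < C \<longrightarrow> t * \<phi> (dist z y) \<le> t * \<phi> (dist z (w n)) + t * e"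
proof (cases "0 < t \<and> 0 \<le> C")
  case False
  have "\<not> t * \<phi> (dist z (w n)) < C" if "t \<noteq> 0" for z n
    using False t that mult_nonneg_nonneg[OF t MI_nonneg[OF \<phi>, of "dist z (w n)"]] by auto
  then show ?thesis by (cases "t = 0") auto
next
  case True
  obtain R where R: "0 \<le> R" "\<phi> R = C / t" using MI_surj[OF \<phi>, of "C / t"] True by auto
  have "uniformly_continuous_on {0..R + 1} \<phi>"
    by (intro compact_uniformly_continuous continuous_on_subset[OF MI_continuous[OF \<phi>]]) auto
  then obtain d where d: "0 < d"
    "\<And>r s. r \<in> {0..R+1} \<Longrightarrow> s \<in> {0..R+1} \<Longrightarrow> dist s r < d \<Longrightarrow> dist (\<phi> s) (\<phi> r) < e"
    using e by (rule uniformly_continuous_onE) blast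
  have "\<forall>\<^sub>F n in sequentially. dist (w n) y < min 1 d"
    using d(1) by (intro tendstoD[OF w]) simp
  then show ?thesis
  proof eventually_elim
    fix n assume n: "dist (w n) y < min 1 d"
    show "\<forall>z. t * \<phi> (dist z (w n)) < C \<longrightarrow> t * \<phi> (dist z y) \<le> t * \<phi> (dist z (w n)) + t * e"
    proof (intro allI impI)
      fix z assume "t * \<phi> (dist z (w n)) < C"
      then have "\<phi> (dist z (w n)) < \<phi> R" using True by (simp add: R(2) less_divide_eq mult.commute)
      then have "dist z (w n) < R" using MI_less_iff[OF \<phi>, of "dist z (w n)" R] R(1) by simp
      moreover have "dist z y \<le> dist z (w n) + dist (w n) y" "dist z (w n) \<le> dist z y + dist (w n) y"
        using dist_triangle[of z y "w n"] dist_triangle[of z "w n" y] by (auto simp: dist_commute)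
      ultimately have "dist (\<phi> (dist z y)) (\<phi> (dist z (w n))) < e"
        using n by (intro d(2)) (auto simp: dist_real_def)
      then have "\<phi> (dist z y) \<le> \<phi> (dist z (w n)) + e" by (auto simp: dist_real_def)
      then show "t * \<phi> (dist z y) \<le> t * \<phi> (dist z (w n)) + t * e"
        using t by (simp flip: distrib_left add: mult_left_mono)
    qed
  qed
qed

text \<open>
  An infimum of continuous functions need not be lower semicontinuous.  Here it is, because a
  \<open>z\<close> that would beat the value at the limit point has bounded cost along every summand, and on such
  \<open>z\<close> the cost varies uniformly little.
\<close>

lemma seq_lsc_INF_point_cost:
  assumes \<phi>: "\<phi> \<in> MI" and \<tau>: "\<tau> \<in> weights K"
  shows "seq_lsc K (\<lambda>x :: nat \<Rightarrow> 'a::polish_space. INF z. point_cost \<phi> K \<tau> x z)"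
  unfolding seq_lsc_def
proof (intro ballI allI impI)
  fix x and u :: "nat \<Rightarrow> nat \<Rightarrow> 'a" and a
  assume u: "\<forall>k<K. (\<lambda>n. u n k) \<longlonglongrightarrow> x k"
  let ?c = "\<lambda>x :: nat \<Rightarrow> 'a. INF z. point_cost \<phi> K \<tau> x z"
  assume a: "a < ?c x"
  have \<tau>0: "0 \<le> \<tau> k" if "k < K" for k using \<tau> that by (auto simp: weights_def)
  define e where "e = (?c x - a) / 2"
  have e: "0 < e" "a < ?c x - e" using a by (auto simp: e_def field_simps)
  let ?near = "\<lambda>k n. \<forall>z. \<tau> k * \<phi> (dist z (u n k)) < ?c x \<longrightarrow>
      \<tau> k * \<phi> (dist z (x k)) \<le> \<tau> k * \<phi> (dist z (u n k)) + \<tau> k * e"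
  have "\<forall>\<^sub>F n in sequentially. \<forall>k\<in>{..<K}. ?near k n"
    using u \<tau>0 e(1) by (intro eventually_ball_finite ballI MI_weighted_dist_uniform[OF \<phi>]) auto
  then show "\<forall>\<^sub>F n in sequentially. a < ?c (u n)"
  proof eventually_elim
    fix n assume n: "\<forall>k\<in>{..<K}. ?near k n"
    have "?c x - e \<le> point_cost \<phi> K \<tau> (u n) z" for z
    proof (cases "?c x \<le> point_cost \<phi> K \<tau> (u n) z")
      case True
      then show ?thesis using e(1) by linarith
    next
      case False
      have lt: "\<tau> k * \<phi> (dist z (u n k)) < ?c x" if k: "k < K" for k
      proof -
        have "\<tau> k * \<phi> (dist z (u n k)) \<le> point_cost \<phi> K \<tau> (u n) z"
          unfolding point_cost_def using k \<tau>0 MI_nonneg[OF \<phi>] by (intro member_le_sum) auto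
        then show ?thesis using False by linarith
      qed
      have "(\<Sum>k<K. \<tau> k * \<phi> (dist z (x k))) \<le> (\<Sum>k<K. \<tau> k * \<phi> (dist z (u n k)) + \<tau> k * e)"
        using n lt by (intro sum_mono) auto
      then have "point_cost \<phi> K \<tau> x z \<le> (\<Sum>k<K. \<tau> k * \<phi> (dist z (u n k)) + \<tau> k * e)"
        by (simp only: point_cost_def)
      also have "\<dots> = point_cost \<phi> K \<tau> (u n) z + e"
        using \<tau> by (simp add: point_cost_def weights_def sum.distrib flip: sum_distrib_right)
      finally show ?thesis using INF_point_cost_le[OF \<phi> \<tau>, of x z] by linarith
    qed
    then have "?c x - e \<le> ?c (u n)" by (intro cINF_greatest) auto
    with e(2) show "a < ?c (u n)" by linarith
  qed
qed

lemma restrict_coupling: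
  assumes \<sigma>: "\<sigma> \<in> couplings (Suc K) (\<mu>(K := \<nu>))"
  shows "distr \<sigma> (borel_pow K) (\<lambda>x. restrict x {..<K}) \<in> couplings K \<mu>"
    and "(\<lambda>x. restrict x {..<K}) \<in> measurable \<sigma> (borel_pow K)"
proof -
  interpret prob_space \<sigma> by (rule couplingsD[OF \<sigma>])
  show m: "(\<lambda>x. restrict x {..<K}) \<in> measurable \<sigma> (borel_pow K)"
    by (intro measurable_restrict couplingsD(5)[OF \<sigma>]) auto
  show "distr \<sigma> (borel_pow K) (\<lambda>x. restrict x {..<K}) \<in> couplings K \<mu>"
  proof (rule couplingsI)
    fix k assume k: "k < K"
    have "distr (distr \<sigma> (borel_pow K) (\<lambda>x. restrict x {..<K})) borel (\<lambda>x. x k) = distr \<sigma> borel (\<lambda>x. x k)"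
      using k by (subst distr_distr[OF _ m]) (auto simp: comp_def)
    then show "distr (distr \<sigma> (borel_pow K) (\<lambda>x. restrict x {..<K})) borel (\<lambda>x. x k) = \<mu> k"
      using couplingsD(4)[OF \<sigma>, of k] k by simp
  qed (auto intro: prob_space_distr m)
qed

lemma multi_cost_restrict:
  assumes \<phi>: "\<phi> \<in> MI" and \<tau>: "\<tau> \<in> weights K" and \<sigma>: "\<sigma> \<in> couplings (Suc K) (\<mu>(K := \<nu>))"
  shows "multi_cost \<phi> K \<tau> (distr \<sigma> (borel_pow K) (\<lambda>x. restrict x {..<K}))
    = (\<integral>\<^sup>+x. ennreal (INF z. point_cost \<phi> K \<tau> x z) \<partial>\<sigma>)"
proof -
  have "multi_cost \<phi> K \<tau> (distr \<sigma> (borel_pow K) (\<lambda>x. restrict x {..<K}))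
      = (\<integral>\<^sup>+x. ennreal (INF z. point_cost \<phi> K \<tau> (restrict x {..<K}) z) \<partial>\<sigma>)"
    unfolding multi_cost_def
    by (rule nn_integral_distr[OF restrict_coupling(2)[OF \<sigma>]])
      (subst measurable_distr_eq1, rule borel_measurable_seq_lsc[OF seq_lsc_INF_point_cost[OF \<phi> \<tau>] INF_point_cost_nonneg[OF \<phi> \<tau>]])
  then show ?thesis by (simp add: point_cost_cong[of K "restrict x {..<K}" x for x])
qed

text \<open>
  Attaching \<open>T x\<close> as a center to \<open>x\<close> turns a coupling of the \<open>\<mu> k\<close> into a star coupling whose cost is the
  infimum cost, because \<open>T x\<close> attains the infimum.
\<close>

lemma barycenter_map_coupling:
  assumes \<phi>: "\<phi> \<in> MI" and \<tau>: "\<tau> \<in> weights K"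
    and T: "borel_barycenter_map \<phi> K \<tau> T" and \<gamma>: "\<gamma> \<in> couplings K \<mu>"
  obtains \<sigma> where "\<sigma> \<in> couplings (Suc K) (\<mu>(K := distr \<gamma> borel T))"
    "(\<integral>\<^sup>+x. ennreal (point_cost \<phi> K \<tau> x (x K)) \<partial>\<sigma>) = multi_cost \<phi> K \<tau> \<gamma>"
proof -
  interpret prob_space \<gamma> by (rule couplingsD[OF \<gamma>])
  note sets = couplingsD(2)[OF \<gamma>]
  have T_meas: "T \<in> measurable \<gamma> borel"
    using T unfolding borel_barycenter_map_def measurable_cong_sets[OF sets refl] by blast
  define h where "h x = (\<lambda>k\<in>{..<Suc K}. if k < K then x k else T x)" for x
  have h: "h \<in> measurable \<gamma> (borel_pow (Suc K))"
    unfolding h_def[abs_def]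
  proof (rule measurable_restrict)
    fix k
    show "(\<lambda>x. if k < K then x k else T x) \<in> measurable \<gamma> borel"
      using couplingsD(5)[OF \<gamma>, of k] T_meas by (cases "k < K") auto
  qed
  define \<sigma> where "\<sigma> = distr \<gamma> (borel_pow (Suc K)) h"
  have "\<sigma> \<in> couplings (Suc K) (\<mu>(K := distr \<gamma> borel T))"
  proof (rule couplingsI)
    show "prob_space \<sigma>" unfolding \<sigma>_def by (rule prob_space_distr[OF h])
    fix k assume k: "k < Suc K"
    have "distr \<sigma> borel (\<lambda>x. x k) = distr \<gamma> borel (\<lambda>x. h x k)"
      unfolding \<sigma>_def using k by (subst distr_distr[OF _ h]) (auto simp: comp_def)
    also have "\<dots> = (\<mu>(K := distr \<gamma> borel T)) k"
      using k couplingsD(4)[OF \<gamma>, of k] by (cases "k < K") (auto simp: h_def less_Suc_eq)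
    finally show "distr \<sigma> borel (\<lambda>x. x k) = (\<mu>(K := distr \<gamma> borel T)) k" .
  qed (simp add: \<sigma>_def)
  moreover have "(\<integral>\<^sup>+x. ennreal (point_cost \<phi> K \<tau> x (x K)) \<partial>\<sigma>) = multi_cost \<phi> K \<tau> \<gamma>"
  proof -
    have "(\<integral>\<^sup>+x. ennreal (point_cost \<phi> K \<tau> x (x K)) \<partial>\<sigma>) = (\<integral>\<^sup>+x. ennreal (point_cost \<phi> K \<tau> (h x) (h x K)) \<partial>\<gamma>)"
      unfolding \<sigma>_def
      by (rule nn_integral_distr[OF h])
        (subst measurable_distr_eq1, rule borel_measurable_seq_lsc[OF seq_lsc_star_cost[OF \<phi>] point_cost_nonneg[OF \<phi> \<tau>]])
    also have "\<dots> = (\<integral>\<^sup>+x. ennreal (INF z. point_cost \<phi> K \<tau> x z) \<partial>\<gamma>)"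
    proof (rule nn_integral_cong)
      fix x assume "x \<in> space \<gamma>"
      then have "\<And>z. point_cost \<phi> K \<tau> x (T x) \<le> point_cost \<phi> K \<tau> x z"
        using T couplingsD(3)[OF \<gamma>] by (auto simp: borel_barycenter_map_def)
      then have "(INF z. point_cost \<phi> K \<tau> x z) = point_cost \<phi> K \<tau> x (T x)"
        using INF_point_cost_le[OF \<phi> \<tau>, of x "T x"] by (intro antisym cINF_greatest) auto
      moreover have "point_cost \<phi> K \<tau> (h x) (h x K) = point_cost \<phi> K \<tau> x (T x)"
        unfolding point_cost_def by (intro sum.cong) (auto simp: h_def)
      ultimately show "ennreal (point_cost \<phi> K \<tau> (h x) (h x K)) = ennreal (INF z. point_cost \<phi> K \<tau> x z)"
        by simp
    qed
    finally show ?thesis by (simp add: multi_cost_def)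
  qed
  ultimately show ?thesis by (rule that)
qed

text \<open>
  Some weight is positive, so finite star cost bounds the mean of \<open>\<phi>\<close> of the distance from the center
  to that \<open>\<mu> k\<close>, and the moment of \<open>\<mu> k\<close> transfers to the center.
\<close>

lemma P_phi_of_star_cost:
  fixes \<mu> :: "nat \<Rightarrow> 'a::polish_space measure"
  assumes \<phi>: "\<phi> \<in> MI" and \<tau>: "\<tau> \<in> weights K" and \<mu>: "\<And>k. k < K \<Longrightarrow> \<mu> k \<in> P_phi \<phi>"
    and \<sigma>: "\<sigma> \<in> couplings (Suc K) (\<mu>(K := \<nu>))" and \<nu>: "\<nu> \<in> borel_probs"
    and fin: "(\<integral>\<^sup>+x. ennreal (point_cost \<phi> K \<tau> x (x K)) \<partial>\<sigma>) < \<infinity>"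
  shows "\<nu> \<in> P_phi \<phi>"
proof -
  obtain k where k: "k < K" "0 < \<tau> k"
  proof (rule ccontr)
    assume "\<not> thesis"
    with that have "\<tau> k \<le> 0" if "k < K" for k using \<open>k < K\<close> not_less by blast
    then have "(\<Sum>k<K. \<tau> k) \<le> 0" by (intro sum_nonpos) simp
    with \<tau> show False by (simp add: weights_def)
  qed
  have \<tau>0: "0 \<le> \<tau> j" if "j < K" for j using \<tau> that by (auto simp: weights_def)
  have K_meas: "(\<lambda>x. x K) \<in> measurable \<sigma> borel" and k_meas: "(\<lambda>x. x k) \<in> measurable \<sigma> borel"
    using k by (auto intro: couplingsD(5)[OF \<sigma>])
  have "ennreal (\<tau> k) * (\<integral>\<^sup>+x. ennreal (\<phi> (dist (x K) (x k))) \<partial>\<sigma>)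
      = (\<integral>\<^sup>+x. ennreal (\<tau> k) * ennreal (\<phi> (dist (x K) (x k))) \<partial>\<sigma>)"
    using borel_measurable_MI_dist[OF \<phi> K_meas k_meas] by (intro nn_integral_cmult[symmetric]) simp
  also have "\<dots> \<le> (\<integral>\<^sup>+x. ennreal (point_cost \<phi> K \<tau> x (x K)) \<partial>\<sigma>)"
    unfolding ennreal_point_cost[OF \<phi> \<tau>]
    using k by (intro nn_integral_mono member_le_sum[of k "{..<K}"]) auto
  finally have *: "(\<integral>\<^sup>+x. ennreal (\<phi> (dist (x K) (x k))) \<partial>\<sigma>) < \<infinity>"
    using fin k(2) by (auto simp: ennreal_mult_less_top dest!: le_less_trans)
  have c: "(\<lambda>y. \<phi> (dist y z)) \<in> borel_measurable borel" for z :: 'a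
    by (intro borel_measurable_MI_dist \<phi>) auto
  have "(\<integral>\<^sup>+x. ennreal (\<phi> (dist x z)) \<partial>\<nu>) < \<infinity>" for z
  proof -
    have "(\<integral>\<^sup>+x. ennreal (\<phi> (dist (x k) z)) \<partial>\<sigma>) < \<infinity>"
      using nn_integral_coupling_component[OF \<sigma>, of k "\<lambda>y. ennreal (\<phi> (dist y z))"] c[of z] \<mu>[of k] k
      by (simp add: P_phi_iff[OF \<phi>])
    then have "(\<integral>\<^sup>+x. ennreal (\<phi> (dist (x K) z)) \<partial>\<sigma>) < \<infinity>"
      by (intro nn_integral_MI_triangle[OF \<phi> couplingsD(1)[OF \<sigma>] K_meas k_meas _ *]) auto
    then show ?thesis
      using nn_integral_coupling_component[OF \<sigma>, of K "\<lambda>y. ennreal (\<phi> (dist y z))"] c[of z] by simp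
  qed
  with \<nu> show ?thesis by (simp add: P_phi_iff[OF \<phi>])
qed

lemma multi_cost_finite:
  fixes \<mu> :: "nat \<Rightarrow> 'a::polish_space measure"
  assumes \<phi>: "\<phi> \<in> MI" and \<tau>: "\<tau> \<in> weights K" and \<mu>: "\<And>k. k < K \<Longrightarrow> \<mu> k \<in> P_phi \<phi>"
    and \<gamma>: "\<gamma> \<in> couplings K \<mu>"
  shows "multi_cost \<phi> K \<tau> \<gamma> < \<infinity>"
proof -
  define z :: 'a where "z = undefined"
  have meas: "(\<lambda>x. \<phi> (dist z (x k))) \<in> borel_measurable \<gamma>" if "k < K" for k
    using that by (intro borel_measurable_MI_dist \<phi> couplingsD(5)[OF \<gamma>]) auto
  have c: "(\<lambda>y. \<phi> (dist z y)) \<in> borel_measurable borel"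
    by (intro borel_measurable_MI_dist \<phi>) auto
  have "multi_cost \<phi> K \<tau> \<gamma> \<le> (\<integral>\<^sup>+x. ennreal (point_cost \<phi> K \<tau> x z) \<partial>\<gamma>)"
    unfolding multi_cost_def by (intro nn_integral_mono ennreal_leI INF_point_cost_le \<phi> \<tau>)
  also have "\<dots> = (\<Sum>k<K. ennreal (\<tau> k) * (\<integral>\<^sup>+x. ennreal (\<phi> (dist z (x k))) \<partial>\<gamma>))"
    unfolding ennreal_point_cost[OF \<phi> \<tau>] by (intro nn_integral_weighted_sum meas)
  also have "\<dots> < \<infinity>"
  proof -
    have "(\<integral>\<^sup>+x. ennreal (\<phi> (dist z (x k))) \<partial>\<gamma>) < \<infinity>" if "k < K" for k
    proof -
      have "(\<integral>\<^sup>+x. ennreal (\<phi> (dist z (x k))) \<partial>\<gamma>) = (\<integral>\<^sup>+y. ennreal (\<phi> (dist z y)) \<partial>\<mu> k)"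
        using c by (intro nn_integral_coupling_component[OF \<gamma> that]) simp
      also have "\<dots> = (\<integral>\<^sup>+y. ennreal (\<phi> (dist y z)) \<partial>\<mu> k)"
        by (intro nn_integral_cong arg_cong[where f = "\<lambda>r. ennreal (\<phi> r)"] dist_commute)
      also have "\<dots> < \<infinity>" using \<mu>[OF that] unfolding P_phi_iff[OF \<phi>] by blast
      finally show ?thesis .
    qed
    then show ?thesis by (auto simp: ennreal_mult_less_top)
  qed
  finally show ?thesis .
qed

text \<open>
  Uniqueness among Borel barycenter maps implies uniqueness of the minimiser at every point: points
  of the power are Borel sets, so \<open>T\<close> may be redefined at a single point by any other minimiser.
\<close>

lemma unique_barycenter_map_pointwise:
  fixes T :: "(nat \<Rightarrow> 'a::polish_space) \<Rightarrow> 'a"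
  assumes T: "borel_barycenter_map \<phi> K \<tau> T"
    and unique: "\<And>T' x. borel_barycenter_map \<phi> K \<tau> T' \<Longrightarrow> x \<in> space (borel_pow K) \<Longrightarrow> T' x = T x"
    and x: "x \<in> space (borel_pow K)" and y: "\<And>z. point_cost \<phi> K \<tau> x y \<le> point_cost \<phi> K \<tau> x z"
  shows "y = T x"
proof -
  define T' where "T' w = (if w = x then y else T w)" for w
  have "x \<in> extensional {..<K}" using x by (simp add: space_PiM PiE_def)
  then have "Pi\<^sub>E {..<K} (\<lambda>k. {x k}) = {x}" by (rule PiE_singleton)
  moreover have "Pi\<^sub>E {..<K} (\<lambda>k. {x k}) \<in> sets (borel_pow K)"
    by (rule sets_PiM_I_finite) auto
  moreover have "{w \<in> space (borel_pow K). w = x} = {x}" using x by auto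
  ultimately have "{w \<in> space (borel_pow K). w = x} \<in> sets (borel_pow K)" by simp
  moreover have "T \<in> measurable (borel_pow K) borel" using T by (simp add: borel_barycenter_map_def)
  ultimately have "T' \<in> measurable (borel_pow K) borel"
    unfolding T'_def by (intro measurable_If) auto
  with T y have "borel_barycenter_map \<phi> K \<tau> T'"
    by (auto simp: borel_barycenter_map_def T'_def)
  from unique[OF this x] show ?thesis by (simp add: T'_def)
qed

section \<open>Barycenters from optimal couplings\<close>

theorem theorem4p3:
  fixes \<phi> :: "real \<Rightarrow> real" and K :: nat and \<tau> :: "nat \<Rightarrow> real"
    and \<mu> :: "nat \<Rightarrow> 'a::polish_space measure"
  assumes "locally_compact_space (euclidean :: 'a topology)"
    and "\<phi> \<in> MI"
    and "K \<ge> 2"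
    and "\<forall>k<K. \<mu> k \<in> P_phi \<phi>"
    and "\<tau> \<in> weights K"
  shows "(\<exists>\<gamma>. optimal_coupling \<phi> K \<tau> \<mu> \<gamma>) \<and>
    (\<forall>T. borel_barycenter_map \<phi> K \<tau> T \<longrightarrow>
      (\<forall>\<gamma>. optimal_coupling \<phi> K \<tau> \<mu> \<gamma> \<longrightarrow> is_barycenter \<phi> K \<tau> \<mu> (distr \<gamma> borel T)) \<and>
      ((\<forall>T'. borel_barycenter_map \<phi> K \<tau> T' \<longrightarrow> (\<forall>x\<in>space (borel_pow K). T' x = T x)) \<longrightarrow>
        (\<forall>\<nu>. is_barycenter \<phi> K \<tau> \<mu> \<nu> \<longrightarrow>
          (\<exists>\<gamma>. optimal_coupling \<phi> K \<tau> \<mu> \<gamma> \<and> \<nu> = distr \<gamma> borel T))))"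
proof -
  note \<phi> = \<open>\<phi> \<in> MI\<close> and \<tau> = \<open>\<tau> \<in> weights K\<close>
  have \<mu>: "\<mu> k \<in> P_phi \<phi>" if "k < K" for k using assms(4) that by blast
  then have \<mu>_probs: "\<mu> k \<in> borel_probs" if "k < K" for k using that by (auto simp: P_phi_def)
  let ?B = "\<lambda>\<nu>. \<Sum>k<K. \<tau> k * \<phi> (W_phi \<phi> \<nu> (\<mu> k))"
  have B_nonneg: "0 \<le> ?B \<nu>" for \<nu>
    using \<tau> by (intro sum_nonneg mult_nonneg_nonneg) (auto simp: weights_def phi_W_phi[OF \<phi>])
  let ?star = "\<lambda>\<sigma>. \<integral>\<^sup>+x. ennreal (point_cost \<phi> K \<tau> x (x K)) \<partial>\<sigma>"
  let ?r = "\<lambda>\<sigma>. distr \<sigma> (borel_pow K) (\<lambda>x. restrict x {..<K})"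
  have restr_le: "multi_cost \<phi> K \<tau> (?r \<sigma>) \<le> ?star \<sigma>"
    if "\<sigma> \<in> couplings (Suc K) (\<mu>(K := \<nu>))" for \<sigma> \<nu>
    unfolding multi_cost_restrict[OF \<phi> \<tau> that]
    by (intro nn_integral_mono ennreal_leI INF_point_cost_le \<phi> \<tau>)

  have ex: "\<exists>\<gamma>. optimal_coupling \<phi> K \<tau> \<mu> \<gamma>"
  proof -
    obtain \<gamma> where "\<gamma> \<in> couplings K \<mu>"
      "\<And>\<gamma>'. \<gamma>' \<in> couplings K \<mu> \<Longrightarrow> multi_cost \<phi> K \<tau> \<gamma> \<le> multi_cost \<phi> K \<tau> \<gamma>'"
      unfolding multi_cost_def
      by (rule optimal_coupling_exists[OF \<mu>_probs seq_lsc_INF_point_cost[OF \<phi> \<tau>] INF_point_cost_nonneg[OF \<phi> \<tau>]]) blast+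
    then show ?thesis unfolding optimal_coupling_def by blast
  qed

  have le_multi: "distr \<gamma> borel T \<in> P_phi \<phi> \<and> ennreal (?B (distr \<gamma> borel T)) \<le> multi_cost \<phi> K \<tau> \<gamma>"
    if T: "borel_barycenter_map \<phi> K \<tau> T" and \<gamma>: "\<gamma> \<in> couplings K \<mu>" for T \<gamma>
  proof -
    obtain \<sigma> where \<sigma>: "\<sigma> \<in> couplings (Suc K) (\<mu>(K := distr \<gamma> borel T))" "?star \<sigma> = multi_cost \<phi> K \<tau> \<gamma>"
      by (rule barycenter_map_coupling[OF \<phi> \<tau> T \<gamma>])
    have "T \<in> measurable \<gamma> borel"
      using T unfolding borel_barycenter_map_def measurable_cong_sets[OF couplingsD(2)[OF \<gamma>] refl] by blast
    then have "distr \<gamma> borel T \<in> borel_probs"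
      using prob_space.prob_space_distr[OF couplingsD(1)[OF \<gamma>]] by (auto simp: borel_probs_def)
    moreover have "?star \<sigma> < \<infinity>"
      using multi_cost_finite[OF \<phi> \<tau> \<mu> \<gamma>] \<sigma>(2) by simp
    ultimately have "distr \<gamma> borel T \<in> P_phi \<phi>"
      by (intro P_phi_of_star_cost[OF \<phi> \<tau> \<mu> \<sigma>(1)])
    with barycenter_functional_le_star_cost[OF \<phi> \<tau> \<sigma>(1)] \<sigma>(2) show ?thesis by simp
  qed

  \<comment> \<open>Star couplings of a competitor restrict to couplings of the \<open>\<mu> k\<close> that cost no more.\<close>
  have bary: "is_barycenter \<phi> K \<tau> \<mu> (distr \<gamma> borel T)"
    if T: "borel_barycenter_map \<phi> K \<tau> T" and \<gamma>: "optimal_coupling \<phi> K \<tau> \<mu> \<gamma>" for T \<gamma>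
    unfolding is_barycenter_def
  proof (intro conjI ballI)
    have \<gamma>_coupling: "\<gamma> \<in> couplings K \<mu>" using \<gamma> by (simp add: optimal_coupling_def)
    note le = le_multi[OF T \<gamma>_coupling]
    show "distr \<gamma> borel T \<in> P_phi \<phi>" using le by blast
    fix \<nu> :: "'a measure" assume \<nu>: "\<nu> \<in> P_phi \<phi>"
    obtain \<sigma> where \<sigma>: "\<sigma> \<in> couplings (Suc K) (\<mu>(K := \<nu>))" "?star \<sigma> \<le> ennreal (?B \<nu>)"
      by (rule star_coupling_exists[OF \<phi> \<tau> \<mu> \<nu>])
    have "ennreal (?B (distr \<gamma> borel T)) \<le> multi_cost \<phi> K \<tau> \<gamma>" using le by blast
    also have "\<dots> \<le> multi_cost \<phi> K \<tau> (?r \<sigma>)"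
      using \<gamma> restrict_coupling(1)[OF \<sigma>(1)] by (simp add: optimal_coupling_def)
    also have "\<dots> \<le> ennreal (?B \<nu>)" using restr_le[OF \<sigma>(1)] \<sigma>(2) by (rule order_trans)
    finally show "?B (distr \<gamma> borel T) \<le> ?B \<nu>" by (simp add: ennreal_le_iff B_nonneg)
  qed

  \<comment> \<open>A star coupling for a barycenter has no room: its center is almost surely a minimiser, that is \<open>T x\<close>.\<close>
  have rep: "\<exists>\<gamma>. optimal_coupling \<phi> K \<tau> \<mu> \<gamma> \<and> \<nu> = distr \<gamma> borel T"
    if T: "borel_barycenter_map \<phi> K \<tau> T"
      and unique: "\<And>T' x. borel_barycenter_map \<phi> K \<tau> T' \<Longrightarrow> x \<in> space (borel_pow K) \<Longrightarrow> T' x = T x"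
      and \<nu>: "is_barycenter \<phi> K \<tau> \<mu> \<nu>" for T \<nu>
  proof -
    obtain \<gamma>0 where \<gamma>0: "optimal_coupling \<phi> K \<tau> \<mu> \<gamma>0" using ex by blast
    then have \<gamma>0_coupling: "\<gamma>0 \<in> couplings K \<mu>" by (simp add: optimal_coupling_def)
    have \<nu>_P: "\<nu> \<in> P_phi \<phi>" using \<nu> by (simp add: is_barycenter_def)
    obtain \<sigma> where \<sigma>: "\<sigma> \<in> couplings (Suc K) (\<mu>(K := \<nu>))" "?star \<sigma> \<le> ennreal (?B \<nu>)"
      by (rule star_coupling_exists[OF \<phi> \<tau> \<mu> \<nu>_P])
    have "ennreal (?B \<nu>) \<le> ennreal (?B (distr \<gamma>0 borel T))"
      using \<nu> le_multi[OF T \<gamma>0_coupling] by (intro ennreal_leI) (auto simp: is_barycenter_def)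
    also have "\<dots> \<le> multi_cost \<phi> K \<tau> \<gamma>0" using le_multi[OF T \<gamma>0_coupling] by blast
    finally have star_le: "?star \<sigma> \<le> multi_cost \<phi> K \<tau> \<gamma>0" using \<sigma>(2) by (rule order_trans[rotated])
    have r_coupling: "?r \<sigma> \<in> couplings K \<mu>" by (rule restrict_coupling(1)[OF \<sigma>(1)])
    have opt: "optimal_coupling \<phi> K \<tau> \<mu> (?r \<sigma>)"
      using \<gamma>0 r_coupling order_trans[OF restr_le[OF \<sigma>(1)] star_le]
      by (auto simp: optimal_coupling_def intro: order_trans)
    have "multi_cost \<phi> K \<tau> \<gamma>0 \<le> multi_cost \<phi> K \<tau> (?r \<sigma>)"
      using \<gamma>0 r_coupling by (simp add: optimal_coupling_def)
    with star_le have star_le': "?star \<sigma> \<le> (\<integral>\<^sup>+x. ennreal (INF z. point_cost \<phi> K \<tau> x z) \<partial>\<sigma>)"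
      unfolding multi_cost_restrict[OF \<phi> \<tau> \<sigma>(1)] by (rule order_trans)

    let ?c = "\<lambda>x :: nat \<Rightarrow> 'a. INF z. point_cost \<phi> K \<tau> x z"
    have \<sigma>_cong: "f \<in> borel_measurable \<sigma> \<longleftrightarrow> f \<in> borel_measurable (borel_pow (Suc K))" for f :: "(nat \<Rightarrow> 'a) \<Rightarrow> ennreal"
      by (rule arg_cong[where f = "\<lambda>A. f \<in> A"], rule measurable_cong_sets[OF couplingsD(2)[OF \<sigma>(1)] refl])
    have star_meas: "(\<lambda>x. ennreal (point_cost \<phi> K \<tau> x (x K))) \<in> borel_measurable \<sigma>"
      unfolding \<sigma>_cong by (rule borel_measurable_seq_lsc[OF seq_lsc_star_cost[OF \<phi>] point_cost_nonneg[OF \<phi> \<tau>]])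
    have c_meas: "(\<lambda>x. ennreal (?c x)) \<in> borel_measurable \<sigma>"
    proof -
      have "(\<lambda>x. ennreal (?c (restrict x {..<K}))) \<in> borel_measurable \<sigma>"
        by (rule measurable_compose[OF restrict_coupling(2)[OF \<sigma>(1)]
              borel_measurable_seq_lsc[OF seq_lsc_INF_point_cost[OF \<phi> \<tau>] INF_point_cost_nonneg[OF \<phi> \<tau>]]])
      then show ?thesis by (simp add: point_cost_cong[of K "restrict x {..<K}" x for x])
    qed
    have c_le: "ennreal (?c x) \<le> ennreal (point_cost \<phi> K \<tau> x (x K))" for x
      by (intro ennreal_leI INF_point_cost_le \<phi> \<tau>)
    have fin: "(\<integral>\<^sup>+x. ennreal (?c x) \<partial>\<sigma>) \<noteq> \<infinity>"
      using multi_cost_finite[OF \<phi> \<tau> \<mu> r_coupling] multi_cost_restrict[OF \<phi> \<tau> \<sigma>(1)] by simp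
    have "(\<integral>\<^sup>+x. ennreal (point_cost \<phi> K \<tau> x (x K)) - ennreal (?c x) \<partial>\<sigma>) = ?star \<sigma> - (\<integral>\<^sup>+x. ennreal (?c x) \<partial>\<sigma>)"
      by (intro nn_integral_diff star_meas c_meas fin) (auto intro: c_le)
    also have "\<dots> = 0"
      using star_le' le_less_trans[OF star_le', of top] fin by (simp add: diff_eq_0_iff_ennreal less_top)
    finally have "AE x in \<sigma>. ennreal (point_cost \<phi> K \<tau> x (x K)) - ennreal (?c x) = 0"
      by (subst (asm) nn_integral_0_iff_AE) (use star_meas c_meas in measurable)
    then have y_eq: "AE x in \<sigma>. x K = T (restrict x {..<K})"
    proof eventually_elim
      fix x :: "nat \<Rightarrow> 'a" assume "ennreal (point_cost \<phi> K \<tau> x (x K)) - ennreal (?c x) = 0"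
      then have "ennreal (point_cost \<phi> K \<tau> x (x K)) \<le> ennreal (?c x)"
        by (simp add: diff_eq_0_iff_ennreal)
      then have le: "point_cost \<phi> K \<tau> x (x K) \<le> ?c x"
        by (rule ennreal_le_iff[OF INF_point_cost_nonneg[OF \<phi> \<tau>], THEN iffD1])
      show "x K = T (restrict x {..<K})"
      proof (rule unique_barycenter_map_pointwise[where \<phi> = \<phi> and K = K and \<tau> = \<tau> and T = T])
        show "borel_barycenter_map \<phi> K \<tau> T" by (rule T)
        show "T' w = T w" if "borel_barycenter_map \<phi> K \<tau> T'" "w \<in> space (borel_pow K)" for T' w
          using that by (rule unique)
        show "restrict x {..<K} \<in> space (borel_pow K)" by (simp add: space_PiM)
        fix z
        have "point_cost \<phi> K \<tau> x (x K) \<le> point_cost \<phi> K \<tau> x z"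
          using le INF_point_cost_le[OF \<phi> \<tau>, of x z] by linarith
        then show "point_cost \<phi> K \<tau> (restrict x {..<K}) (x K) \<le> point_cost \<phi> K \<tau> (restrict x {..<K}) z"
          by (simp add: point_cost_cong[of K "restrict x {..<K}" x])
      qed
    qed
    have T_meas: "T \<in> measurable (borel_pow K) borel" using T by (simp add: borel_barycenter_map_def)
    have "\<nu> = distr \<sigma> borel (\<lambda>x. x K)" using couplingsD(4)[OF \<sigma>(1), of K] by simp
    also have "\<dots> = distr \<sigma> borel (\<lambda>x. T (restrict x {..<K}))"
      by (intro distr_cong_AE y_eq refl couplingsD(5)[OF \<sigma>(1)] lessI
          measurable_compose[OF restrict_coupling(2)[OF \<sigma>(1)] T_meas])
    also have "\<dots> = distr (?r \<sigma>) borel T"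
      by (subst distr_distr[OF T_meas restrict_coupling(2)[OF \<sigma>(1)]]) (simp add: comp_def)
    finally show ?thesis using opt by blast
  qed

  show ?thesis using ex bary rep by blast
qed

end
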